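(* Let $(\Omega,\mu)$ be a $\sigma$-compact topological space endowed with a positive regular Borel measure $\mu$, let $\Phi$ be a locally integrable complex function on $\Omega$, and let $(A(u))_{u\in\Omega}$ be a $\mu$-measurable family of real $n\times n$ matrices such that the matrices $A(v)$, $v$ in the support of $\Phi$, pairwise commute and are positive definite. Let $1\le p\le\infty$ and suppose $(\det A(v))^{-1/p}\Phi(v)\in L^1(\Omega,\mu)$ (with $1/p=0$ for $p=\infty$). Consider the Hausdorff operator on $L^p(\mathbb{R}^n)$ $$(\mathcal{H}_{\Phi,A}f)(x)=\int_\Omega \Phi(u)f(A(u)x)\,d\mu(u),\qquad x\in\mathbb{R}^n \text{ (column vector)}.$$ If $\mathcal{H}_{\Phi,A}\neq 0$, then $\mathcal{H}_{\Phi,A}$ is not a Riesz operator on $L^p(\mathbb{R}^n)$ (in particular, it is not compact).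
   Context: Under the integrability hypothesis, $\mathcal{H}_{\Phi,A}$ is a bounded operator on $L^p(\mathbb{R}^n)$ with norm at most $\int_\Omega|\Phi(u)||\det A(u)|^{-1/p}d\mu(u)$. A real positive definite matrix here means a real symmetric matrix with positive eigenvalues. A bounded operator $T$ on a Banach space is a Riesz operator if $T-\lambda I$ is Fredholm for every complex $\lambda\ne 0$ (equivalently, $T$ is non-invertible and its nonzero spectrum consists of eigenvalues of finite multiplicity with no limit points other than $0$). *)

theory Defs
  imports "HOL-Analysis.Analysis" "HOL-Probability.Essential_Supremum"
begin

text \<open>Elements of L^p are represented by Borel measurable functions; two representatives
  are identified when they agree almost everywhere (w.r.t. Lebesgue measure).\<close>

definition Lp_space :: "ennreal \<Rightarrow> (real^'n \<Rightarrow> complex) set" where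
  "Lp_space p = {f. f \<in> borel_measurable lborel \<and>
     (if p = \<infinity> then esssup lborel (\<lambda>x. ereal (norm (f x))) < \<infinity>
      else (\<integral>\<^sup>+ x. ennreal (norm (f x) powr enn2real p) \<partial>lborel) < \<infinity>)}"

definition Lp_norm :: "ennreal \<Rightarrow> (real^'n \<Rightarrow> complex) \<Rightarrow> real" where
  "Lp_norm p f = (if p = \<infinity> then real_of_ereal (esssup lborel (\<lambda>x. ereal (norm (f x))))
     else (enn2real (\<integral>\<^sup>+ x. ennreal (norm (f x) powr enn2real p) \<partial>lborel)) powr (1 / enn2real p))"

definition Lp_range :: "ennreal \<Rightarrow> ((real^'n \<Rightarrow> complex) \<Rightarrow> (real^'n \<Rightarrow> complex)) \<Rightarrow> (real^'n \<Rightarrow> complex) set" where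
  "Lp_range p S = {h \<in> Lp_space p. \<exists>f \<in> Lp_space p. AE x in lborel. S f x = h x}"

definition Lp_fredholm :: "ennreal \<Rightarrow> ((real^'n \<Rightarrow> complex) \<Rightarrow> (real^'n \<Rightarrow> complex)) \<Rightarrow> bool" where
  "Lp_fredholm p S \<longleftrightarrow>
     (\<exists>F. finite F \<and> F \<subseteq> Lp_space p \<and>
        (\<forall>f \<in> Lp_space p. (AE x in lborel. S f x = 0) \<longrightarrow>
           (\<exists>c. AE x in lborel. f x = (\<Sum>g\<in>F. c g * g x)))) \<and>
     (\<forall>g h. (\<forall>k::nat. g k \<in> Lp_range p S) \<longrightarrow> h \<in> Lp_space p \<longrightarrow>
        (\<lambda>k. Lp_norm p (\<lambda>x. g k x - h x)) \<longlonglongrightarrow> 0 \<longrightarrow> h \<in> Lp_range p S) \<and>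
     (\<exists>F. finite F \<and> F \<subseteq> Lp_space p \<and>
        (\<forall>h \<in> Lp_space p. \<exists>f \<in> Lp_space p. \<exists>c.
           AE x in lborel. h x = S f x + (\<Sum>g\<in>F. c g * g x)))"

definition Lp_riesz :: "ennreal \<Rightarrow> ((real^'n \<Rightarrow> complex) \<Rightarrow> (real^'n \<Rightarrow> complex)) \<Rightarrow> bool" where
  "Lp_riesz p T \<longleftrightarrow> (\<forall>c::complex. c \<noteq> 0 \<longrightarrow> Lp_fredholm p (\<lambda>f x. T f x - c * f x))"

definition hausdorff_op :: "'a measure \<Rightarrow> ('a \<Rightarrow> complex) \<Rightarrow> ('a \<Rightarrow> real^'n^'n)
    \<Rightarrow> (real^'n \<Rightarrow> complex) \<Rightarrow> (real^'n \<Rightarrow> complex)" where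
  "hausdorff_op M \<Phi> A f = (\<lambda>x. LINT u|M. \<Phi> u * f (A u *v x))"

definition sigma_compact_space :: "'a::topological_space itself \<Rightarrow> bool" where
  "sigma_compact_space _ \<longleftrightarrow> (\<exists>K::nat \<Rightarrow> 'a set. (\<forall>i. compact (K i)) \<and> (\<Union>i. K i) = UNIV)"

definition regular_borel_measure :: "'a::topological_space measure \<Rightarrow> bool" where
  "regular_borel_measure M \<longleftrightarrow> sets M = sets borel \<and>
     (\<forall>B \<in> sets M. emeasure M B = (INF U \<in> {U. open U \<and> B \<subseteq> U}. emeasure M U)) \<and>
     (\<forall>B \<in> sets M. emeasure M B = (SUP K \<in> {K. compact K \<and> K \<in> sets M \<and> K \<subseteq> B}. emeasure M K))"

definition locally_integrable :: "'a::topological_space measure \<Rightarrow> ('a \<Rightarrow> complex) \<Rightarrow> bool" where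
  "locally_integrable M \<Phi> \<longleftrightarrow> \<Phi> \<in> borel_measurable M \<and>
     (\<forall>K. compact K \<and> K \<in> sets M \<longrightarrow> set_integrable M K \<Phi>)"

definition pos_def_matrix :: "real^'n^'n \<Rightarrow> bool" where
  "pos_def_matrix B \<longleftrightarrow> transpose B = B \<and>
     (\<forall>(l::real) x. x \<noteq> 0 \<and> B *v x = l *\<^sub>R x \<longrightarrow> l > 0)"

definition inv_exp :: "ennreal \<Rightarrow> real" where
  "inv_exp p = (if p = \<infinity> then 0 else 1 / enn2real p)"

end

theory Submission
  imports Defs "HOL-Probability.Probability"
begin

text \<open>
  Diagonalise the commuting matrices simultaneously. In the logarithmic coordinates of an orthant
  the operator becomes, after multiplication by the weight \<open>(\<Prod>x\<^sub>i)\<close> to the power \<open>1/p\<close>,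
  the average of translations with respect to a finite complex measure \<open>\<nu>\<close>. If the operator is
  nonzero, then the Fourier transform of \<open>\<nu>\<close> takes a value \<open>\<lambda> \<noteq> 0\<close> at some frequency \<open>\<xi>\<close>.

  The range of \<open>T - \<lambda>\<close> has infinite codimension, by a gliding hump argument. A character of
  frequency \<open>\<xi>\<close>, cut off by a tent function on a cube of side \<open>r\<close> and normalised in the dual space,
  is an approximate eigenfunction of the adjoint: its pairing with \<open>(T - \<lambda>) f\<close> is at most
  \<open>C\<^sub>f \<epsilon>(r)\<close> with \<open>\<epsilon>(r) \<longlongrightarrow> 0\<close>. Choose disjoint cubes with \<open>\<epsilon>(r\<^sub>k)\<close> at most \<open>4\<close> to the power \<open>-k\<close>, and functions
  that pair with the \<open>k\<close>-th test function to about \<open>2\<close> to the power \<open>-k\<close> along one residue class of \<open>k\<close>. Then no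
  nontrivial combination of functions belonging to different classes is in the range.
\<close>

text \<open>The test functions belong to the dual exponent and pair with \<open>L^p\<close> by
  absolutely convergent integrals for every \<open>p\<close> from 1 to infinity, so both endpoints
  follow the same path and no description of the dual space is required. No moment of the
  logarithmic shifts is assumed to be finite, hence \<epsilon>(r) tends to 0 at no known rate; this
  is why the side of each cube is chosen separately. The constant attached to a solution
  \<open>f\<close> is unknown, so no single cube gives a contradiction: masses and errors must decay
  at different geometric rates, and each residue class must be infinite, in order that the ratio of
  the two rates finally beats all the constants. A single orthant carries the argument, because the
  dilations preserve it.\<close>

section \<open>Simultaneous diagonalisation and orthogonal invariance\<close>

text \<open>Gaussian elimination, one equation of \<open>F\<close> per induction step: an unknown
  with nonzero coefficient is the pivot and leaves \<open>J\<close>. It later combines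
  \<open>card F + 1\<close> functions so that their components along \<open>F\<close>
  cancel.\<close>

lemma exists_nontrivial_relation:
  fixes c :: "'j \<Rightarrow> 'g \<Rightarrow> 'k::field"
  assumes "finite F" "finite J" "card F < card J"
  shows "\<exists>a. (\<exists>j\<in>J. a j \<noteq> 0) \<and> (\<forall>g\<in>F. (\<Sum>j\<in>J. a j * c j g) = 0)"
  using assms
proof (induction F arbitrary: J c rule: finite_induct)
  case empty
  then have "J \<noteq> {}" by auto
  then show ?case by (intro exI[of _ "\<lambda>_. 1"]) auto
next
  case (insert g F)
  show ?case
  proof (cases "\<forall>j\<in>J. c j g = 0")
    case True
    have "card F < card J" using insert by simp
    from insert.IH[OF \<open>finite J\<close> this, of c] True show ?thesis by auto
  next
    case False
    then obtain i where i: "i \<in> J" "c i g \<noteq> 0" by auto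
    have "card F < card (J - {i})" using insert i by simp
    from insert.IH[OF _ this, of "\<lambda>j h. c j h - c j g / c i g * c i h"] \<open>finite J\<close>
    obtain a where a: "\<exists>j\<in>J - {i}. a j \<noteq> 0"
      "\<And>h. h \<in> F \<Longrightarrow> (\<Sum>j\<in>J - {i}. a j * (c j h - c j g / c i g * c i h)) = 0"
      by auto
    \<comment> \<open>The pivot entry is the one value that makes equation \<open>g\<close> hold;
      inserting it turns the other equations into the eliminated ones.\<close>
    define b where "b = a(i := - (\<Sum>j\<in>J - {i}. a j * c j g / c i g))"
    have split: "(\<Sum>j\<in>J. b j * c j h) = (\<Sum>j\<in>J - {i}. a j * (c j h - c j g / c i g * c i h))" for h
    proof -
      have "(\<Sum>j\<in>J. b j * c j h) = b i * c i h + (\<Sum>j\<in>J - {i}. b j * c j h)"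
        using \<open>finite J\<close> i by (simp add: sum.remove)
      also have "(\<Sum>j\<in>J - {i}. b j * c j h) = (\<Sum>j\<in>J - {i}. a j * c j h)"
        by (rule sum.cong) (auto simp: b_def)
      also have "b i * c i h = - (\<Sum>j\<in>J - {i}. a j * (c j g / c i g * c i h))"
        by (simp add: b_def sum_distrib_right mult.assoc)
      finally show ?thesis by (simp add: right_diff_distrib sum_subtractf)
    qed
    have "(\<Sum>j\<in>J. b j * c j g) = 0" unfolding split using i by (auto intro!: sum.neutral)
    moreover have "(\<Sum>j\<in>J. b j * c j h) = 0" if "h \<in> F" for h unfolding split using a that by auto
    moreover have "\<exists>j\<in>J. b j \<noteq> 0" using a by (auto simp: b_def)
    ultimately show ?thesis by (intro exI[of _ b]) auto
  qed
qed

section \<open>Common orthonormal eigenvectors of commuting symmetric matrices\<close>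

lemma symmetric_matrix_inner:
  fixes A :: "real^'n^'n"
  assumes "transpose A = A"
  shows "(A *v x) \<bullet> y = x \<bullet> (A *v y)"
  by (metis assms dot_lmul_matrix vector_transpose_matrix)

text \<open>A maximiser \<open>x\<close> of the Rayleigh quotient on the unit sphere of
  \<open>V\<close> works: with maximum \<open>l\<close>, the form of \<open>l - A\<close> is
  nonnegative on \<open>V\<close> and zero at \<open>x\<close>, and a nonnegative form annihilates
  its null vectors.\<close>

lemma symmetric_matrix_eigenvector:
  fixes A :: "real^'n^'n"
  assumes sym: "transpose A = A" and V: "subspace V" "V \<noteq> {0}" and inv: "\<And>x. x \<in> V \<Longrightarrow> A *v x \<in> V"
  shows "\<exists>x\<in>V. x \<noteq> 0 \<and> (\<exists>l. A *v x = l *\<^sub>R x)"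
proof -
  let ?K = "sphere 0 1 \<inter> V"
  have K: "compact ?K" using closed_subspace[OF V(1)] by (intro compact_Int_closed) auto
  obtain v where v: "v \<in> V" "v \<noteq> 0" using V subspace_0 by blast
  then have "(1 / norm v) *\<^sub>R v \<in> ?K" using V(1) by (auto simp: subspace_scale)
  then have K0: "?K \<noteq> {}" by blast
  have "continuous_on ?K (\<lambda>x. x \<bullet> (A *v x))"
    by (rule continuous_on_inner[OF continuous_on_id linear_continuous_on[OF matrix_vector_mul_bounded_linear]])
  from continuous_attains_sup[OF K K0 this]
  obtain x where x: "x \<in> ?K" and max: "\<And>y. y \<in> ?K \<Longrightarrow> y \<bullet> (A *v y) \<le> x \<bullet> (A *v x)"
    by blast
  define l where "l = x \<bullet> (A *v x)"
  define B where "B y = l *\<^sub>R y - A *v y" for y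
  have Badd: "B (y + t *\<^sub>R z) = B y + t *\<^sub>R B z" for y z t
    by (simp add: B_def matrix_vector_right_distrib algebra_simps matrix_vector_mult_scaleR)
  have Bsym: "B y \<bullet> z = y \<bullet> B z" for y z
    by (simp add: B_def inner_diff_left inner_diff_right symmetric_matrix_inner[OF sym])
  have pos: "0 \<le> y \<bullet> B y" if "y \<in> V" for y
  proof (cases "y = 0")
    case False
    have "(1 / norm y) *\<^sub>R y \<in> ?K" using that False V(1) by (auto simp: subspace_scale)
    from max[OF this] have "(y \<bullet> (A *v y)) / (norm y)\<^sup>2 \<le> l"
      by (simp add: l_def matrix_vector_mult_scaleR power2_eq_square)
    then show ?thesis using False
      by (simp add: B_def inner_diff_right field_simps power2_norm_eq_inner)
  qed auto
  have x1: "x \<in> V" "x \<bullet> x = 1" using x by (auto simp: norm_eq_1)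
  have Bx: "B x \<in> V" using V(1) x1 inv by (simp add: B_def subspace_diff subspace_scale)
  define b c where "b = B x \<bullet> B x" and "c = B x \<bullet> B (B x)"
  have "0 \<le> c" unfolding c_def by (rule pos[OF Bx])
  have xBx: "x \<bullet> B x = 0" by (simp add: B_def l_def inner_diff_right x1)
  \<comment> \<open>The minimiser of \<open>2 * t * b + t^2 * c\<close> would be
    \<open>- b / c\<close>; the denominator \<open>c + 1\<close> also covers \<open>c = 0\<close>
    and still makes the expression negative unless \<open>b = 0\<close>.\<close>
  define t where "t = - b / (c + 1)"
  have "x + t *\<^sub>R B x \<in> V" using V(1) x1 Bx by (simp add: subspace_add subspace_scale)
  from pos[OF this] have "0 \<le> 2 * t * b + t\<^sup>2 * c"
    unfolding Badd by (simp add: inner_add_left inner_add_right xBx b_def c_def Bsym power2_eq_square algebra_simps)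
  then have "0 \<le> (2 * t * b + t\<^sup>2 * c) * (c + 1)\<^sup>2" by simp
  also have "\<dots> = 2 * (t * (c + 1)) * b * (c + 1) + (t * (c + 1))\<^sup>2 * c" by algebra
  also have "t * (c + 1) = - b" using \<open>0 \<le> c\<close> by (simp add: t_def)
  finally have "b\<^sup>2 * (c + 2) \<le> 0" by (simp add: power2_eq_square algebra_simps)
  then have "b = 0" using \<open>0 \<le> c\<close> by (simp add: mult_le_0_iff)
  then have "A *v x = l *\<^sub>R x" by (simp add: b_def B_def)
  moreover have "x \<noteq> 0" using x1 by auto
  ultimately show ?thesis using x1 by blast
qed

text \<open>In an invariant subspace of least dimension, an eigenspace of one matrix is invariant
  under all the others, because they commute, and so fills the subspace. Its nonzero vectors are
  then eigenvectors of every matrix, however large the family.\<close>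

lemma commuting_symmetric_common_eigenvector:
  fixes \<A> :: "(real^'n^'n) set"
  assumes sym: "\<And>A. A \<in> \<A> \<Longrightarrow> transpose A = A"
    and com: "\<And>A B. A \<in> \<A> \<Longrightarrow> B \<in> \<A> \<Longrightarrow> A ** B = B ** A"
    and V: "subspace V" "V \<noteq> {0}" "\<And>A x. A \<in> \<A> \<Longrightarrow> x \<in> V \<Longrightarrow> A *v x \<in> V"
  shows "\<exists>x\<in>V. norm x = 1 \<and> (\<forall>A\<in>\<A>. \<exists>l. A *v x = l *\<^sub>R x)"
proof -
  define P where "P W \<longleftrightarrow> subspace W \<and> W \<noteq> {0} \<and> W \<subseteq> V \<and> (\<forall>A\<in>\<A>. \<forall>x\<in>W. A *v x \<in> W)" for W
  have "P V" using V by (auto simp: P_def)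
  then obtain W where W: "P W" and min: "\<And>W'. P W' \<Longrightarrow> dim W \<le> dim W'"
    using ex_has_least_nat[of P V dim] by blast
  have sW: "subspace W" using W by (simp add: P_def)
  obtain x where x: "x \<in> W" "x \<noteq> 0" using W subspace_0 unfolding P_def by blast
  have eig: "\<exists>l. A *v x = l *\<^sub>R x" if A: "A \<in> \<A>" for A
  proof -
    obtain y l where y: "y \<in> W" "y \<noteq> 0" "A *v y = l *\<^sub>R y"
      using symmetric_matrix_eigenvector[OF sym[OF A] sW] W A unfolding P_def by blast
    define U where "U = {z\<in>W. A *v z = l *\<^sub>R z}"
    have sU: "subspace U" using sW unfolding U_def subspace_def
      by (auto simp: matrix_vector_right_distrib algebra_simps matrix_vector_mult_scaleR)
    have "B *v z \<in> U" if "B \<in> \<A>" "z \<in> U" for B z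
    proof -
      have "A *v (B *v z) = B *v (A *v z)"
        using com[OF A that(1)] by (simp add: matrix_vector_mul_assoc)
      then show ?thesis using that W by (auto simp: U_def P_def matrix_vector_mult_scaleR)
    qed
    then have "P U" using sU y W by (auto simp: P_def U_def)
    from min[OF this] have "U = W" using subspace_dim_equal[OF sU sW] by (auto simp: U_def)
    then show ?thesis using x by (auto simp: U_def)
  qed
  let ?u = "(1 / norm x) *\<^sub>R x"
  have "?u \<in> V" using subspace_scale[OF sW x(1)] W by (auto simp: P_def)
  moreover have "norm ?u = 1" using x by simp
  moreover have "\<exists>l. A *v ?u = l *\<^sub>R ?u" if "A \<in> \<A>" for A
    using eig[OF that] by (auto simp: matrix_vector_mult_scaleR)
  ultimately show ?thesis by blast
qed

text \<open>Take an orthonormal set of common eigenvectors of maximal size. If it did not span, its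
  orthogonal complement would be invariant by symmetry and would contain a further common
  eigenvector.\<close>

theorem commuting_symmetric_diagonalization:
  fixes \<A> :: "(real^'n^'n) set"
  assumes sym: "\<And>A. A \<in> \<A> \<Longrightarrow> transpose A = A"
    and com: "\<And>A B. A \<in> \<A> \<Longrightarrow> B \<in> \<A> \<Longrightarrow> A ** B = B ** A"
  obtains Q :: "real^'n^'n" where "orthogonal_matrix Q"
    "\<And>A i. A \<in> \<A> \<Longrightarrow> \<exists>l. A *v row i Q = l *\<^sub>R row i Q"
proof -
  define P where "P B \<longleftrightarrow> pairwise orthogonal B \<and> (\<forall>b\<in>B. norm b = 1 \<and> (\<forall>A\<in>\<A>. \<exists>l. A *v b = l *\<^sub>R b))"
    for B :: "(real^'n) set"
  have fin: "finite B \<and> card B \<le> CARD('n)" if "P B" for B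
  proof -
    have "independent B" using that by (intro pairwise_orthogonal_independent) (auto simp: P_def)
    from independent_bound[OF this] show ?thesis by simp
  qed
  have "P {}" by (simp add: P_def)
  then obtain B where B: "P B" and max: "\<And>B'. P B' \<Longrightarrow> card B' \<le> card B"
    using ex_has_greatest_nat[of P "{}" card "CARD('n) + 1"] fin by (auto simp: less_Suc_eq_le)
  have UNIV: "span B = UNIV"
  proof (rule ccontr)
    assume *: "span B \<noteq> UNIV"
    define V where "V = {y. \<forall>b\<in>B. orthogonal b y}"
    have V: "subspace V" using subspace_orthogonal_to_vectors[of B] by (simp add: V_def orthogonal_commute)
    obtain a where "a \<noteq> 0" "\<forall>x\<in>span B. a \<bullet> x = 0" using span_not_UNIV_orthogonal[OF *] by blast
    then have "a \<in> V" "a \<noteq> 0" by (auto simp: V_def orthogonal_def span_base inner_commute)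
    then have "V \<noteq> {0}" by auto
    moreover have "A *v x \<in> V" if A: "A \<in> \<A>" and x: "x \<in> V" for A x
    proof -
      have "b \<bullet> (A *v x) = 0" if b: "b \<in> B" for b
      proof -
        obtain l where "A *v b = l *\<^sub>R b" using B A b unfolding P_def by blast
        then have "(A *v b) \<bullet> x = 0" using x b by (simp add: V_def orthogonal_def)
        then show ?thesis by (simp add: symmetric_matrix_inner[OF sym[OF A]])
      qed
      then show ?thesis by (simp add: V_def orthogonal_def)
    qed
    ultimately obtain x where x: "x \<in> V" "norm x = 1" "\<forall>A\<in>\<A>. \<exists>l. A *v x = l *\<^sub>R x"
      using commuting_symmetric_common_eigenvector[of \<A> V, OF sym com V] by blast
    have "x \<notin> B" using x by (auto simp: V_def orthogonal_def)
    moreover have "P (insert x B)" using B x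
      by (auto simp: P_def pairwise_insert V_def orthogonal_commute)
    ultimately show False using max[of "insert x B"] fin[OF B] by simp
  qed
  have "card B = CARD('n)"
  proof -
    have "independent B" using B by (intro pairwise_orthogonal_independent) (auto simp: P_def)
    then have "dim (span B) = card B" by (simp add: dim_eq_card_independent)
    then show ?thesis by (simp add: UNIV)
  qed
  then obtain f where f: "bij_betw f (UNIV :: 'n set) B"
    using fin[OF B] finite_same_card_bij[of "UNIV :: 'n set" B] by auto
  define Q :: "real^'n^'n" where "Q = (\<chi> i. f i)"
  have row: "row i Q = f i" for i by (simp add: Q_def row_def vec_eq_iff)
  have inB: "f i \<in> B" for i using f by (auto simp: bij_betw_def)
  have inj: "f i \<noteq> f j" if "i \<noteq> j" for i j using f that by (auto simp: bij_betw_def inj_def)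
  have "orthogonal_matrix Q"
    unfolding orthogonal_matrix_orthonormal_rows row
    using B inB inj unfolding P_def pairwise_def by blast
  moreover have "\<exists>l. A *v row i Q = l *\<^sub>R row i Q" if "A \<in> \<A>" for A i
    unfolding row using B inB that unfolding P_def by blast
  ultimately show ?thesis using that by blast
qed

section \<open>Lebesgue integrals under translations, reflections and orthogonal maps\<close>

lemma nn_integral_lborel_translate:
  fixes f :: "'a::euclidean_space \<Rightarrow> ennreal"
  assumes [measurable]: "f \<in> borel_measurable borel"
  shows "(\<integral>\<^sup>+x. f (c + x) \<partial>lborel) = (\<integral>\<^sup>+x. f x \<partial>lborel)"
proof -
  have "(\<integral>\<^sup>+x. f x \<partial>lborel) = (\<integral>\<^sup>+x. f x \<partial>distr lborel borel ((+) c))"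
    by (simp add: lborel_distr_plus)
  then show ?thesis by (simp add: nn_integral_distr)
qed

lemma nn_integral_lborel_reflect:
  fixes f :: "'a::euclidean_space \<Rightarrow> ennreal"
  assumes [measurable]: "f \<in> borel_measurable borel"
  shows "(\<integral>\<^sup>+x. f (c - x) \<partial>lborel) = (\<integral>\<^sup>+x. f x \<partial>lborel)"
proof -
  have "(\<integral>\<^sup>+x. f x \<partial>lborel)
    = (\<integral>\<^sup>+x. f x \<partial>density (distr lborel borel (\<lambda>x. c + (-1) *\<^sub>R x)) (\<lambda>_. \<bar>-1::real\<bar>^DIM('a)))"
    by (subst lborel_affine[of "-1" c]) auto
  then show ?thesis by (simp add: nn_integral_density nn_integral_distr)
qed

text \<open>Uniqueness of Haar measure: both factorisations of
  \<open>\<integral>\<integral> f (Q x) * g (Q x + y)\<close> coincide, and a ball is a test set on which the two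
  measures agree.\<close>

lemma nn_integral_lborel_orthogonal:
  fixes Q :: "'a::euclidean_space \<Rightarrow> 'a"
  assumes Q: "orthogonal_transformation Q" and f[measurable]: "f \<in> borel_measurable borel"
  shows "(\<integral>\<^sup>+x. f (Q x) \<partial>lborel) = (\<integral>\<^sup>+x. f x \<partial>lborel)"
proof -
  have lin: "linear Q" using Q by (simp add: orthogonal_transformation_linear)
  have [measurable]: "Q \<in> borel_measurable borel"
    using lin by (intro borel_measurable_continuous_onI linear_continuous_on) (simp add: linear_conv_bounded_linear)
  define g :: "'a \<Rightarrow> ennreal" where "g = indicator (ball 0 1)"
  have [measurable]: "g \<in> borel_measurable borel" unfolding g_def by (intro borel_measurable_indicator borel_open open_ball)
  have gQ: "g (Q x) = g x" for x
    using Q by (simp add: g_def indicator_def orthogonal_transformation_norm)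
  have "(\<integral>\<^sup>+x. f (Q x) \<partial>lborel) * (\<integral>\<^sup>+y. g y \<partial>lborel)
    = (\<integral>\<^sup>+x. (\<integral>\<^sup>+y. f (Q x) * g (Q x + y) \<partial>lborel) \<partial>lborel)"
    by (simp add: nn_integral_cmult nn_integral_lborel_translate nn_integral_multc)
  also have "\<dots> = (\<integral>\<^sup>+y. (\<integral>\<^sup>+x. f (Q x) * g (Q x + y) \<partial>lborel) \<partial>lborel)"
    by (rule lborel_pair.Fubini') measurable
  also have "\<dots> = (\<integral>\<^sup>+y. (\<integral>\<^sup>+x. f (Q x - y) * g (Q x) \<partial>lborel) \<partial>lborel)"
  proof (rule nn_integral_cong)
    fix y
    \<comment> \<open>Translating \<open>x\<close> by \<open>- z\<close> moves \<open>y\<close> from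
      the factor \<open>g\<close> to the factor \<open>f\<close>, after which the two integrations
      separate.\<close>
    obtain z where z: "Q z = y" using orthogonal_transformation_surj[OF Q] by (metis surjD)
    have "(\<integral>\<^sup>+x. f (Q x) * g (Q x + y) \<partial>lborel) = (\<integral>\<^sup>+x. f (Q (-z + x)) * g (Q (-z + x) + y) \<partial>lborel)"
      by (subst nn_integral_lborel_translate[of "\<lambda>x. f (Q x) * g (Q x + y)" "-z"]) auto
    then show "(\<integral>\<^sup>+x. f (Q x) * g (Q x + y) \<partial>lborel) = (\<integral>\<^sup>+x. f (Q x - y) * g (Q x) \<partial>lborel)"
      by (simp add: linear_add[OF lin] linear_diff[OF lin] z)
  qed
  also have "\<dots> = (\<integral>\<^sup>+x. (\<integral>\<^sup>+y. f (Q x - y) * g (Q x) \<partial>lborel) \<partial>lborel)"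
    by (rule lborel_pair.Fubini') measurable
  also have "\<dots> = (\<integral>\<^sup>+x. f x \<partial>lborel) * (\<integral>\<^sup>+x. g x \<partial>lborel)"
    by (simp add: nn_integral_multc nn_integral_lborel_reflect gQ nn_integral_cmult)
  finally have eq: "(\<integral>\<^sup>+x. f (Q x) \<partial>lborel) * (\<integral>\<^sup>+y. g y \<partial>lborel) = (\<integral>\<^sup>+x. f x \<partial>lborel) * (\<integral>\<^sup>+y. g y \<partial>lborel)" .
  have "(\<integral>\<^sup>+y. g y \<partial>lborel) = emeasure lborel (ball 0 1 :: 'a set)" by (simp add: g_def)
  moreover have "emeasure lborel (ball 0 1 :: 'a set) \<noteq> 0"
    using content_ball_pos[of 1 "0::'a"] by (auto simp: measure_def)
  moreover have "emeasure lborel (ball 0 1 :: 'a set) < \<infinity>" by (rule emeasure_bounded_finite) simp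
  ultimately show ?thesis using arg_cong[OF eq, of "\<lambda>t. t / (\<integral>\<^sup>+y. g y \<partial>lborel)"]
    by (simp add: ennreal_mult_divide_eq)
qed

section \<open>Uniqueness of Fourier transforms of weighted images\<close>

text \<open>Levy's uniqueness theorem concerns probability measures. The value of
  \<open>char\<close> at 0 is the total mass, so both measures can be divided by the same number;
  mass 0 cannot be normalised and is treated apart.\<close>

lemma finite_measure_eq_if_char_eq:
  fixes M1 M2 :: "real measure"
  assumes "finite_measure M1" "finite_measure M2"
    and s: "sets M1 = sets borel" "sets M2 = sets borel"
    and char: "\<And>t. char M1 t = char M2 t"
  shows "M1 = M2"
proof -
  interpret M1: finite_measure M1 by fact
  interpret M2: finite_measure M2 by fact
  have sp: "space M1 = UNIV" "space M2 = UNIV"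
    using sets_eq_imp_space_eq[OF s(1)] sets_eq_imp_space_eq[OF s(2)] by simp_all
  have "complex_of_real (measure M1 UNIV) = complex_of_real (measure M2 UNIV)"
    using char[of 0] by (simp add: char_def sp)
  then have m: "measure M1 UNIV = measure M2 UNIV" by simp
  show ?thesis
  proof (cases "measure M1 UNIV = 0")
    case True
    then have "emeasure M1 UNIV = 0" "emeasure M2 UNIV = 0"
      using m by (simp_all add: M1.emeasure_eq_measure M2.emeasure_eq_measure)
    then have "emeasure M1 A = 0" "emeasure M2 A = 0" for A
      using emeasure_space[of M1 A] emeasure_space[of M2 A] by (simp_all add: sp)
    then show ?thesis by (intro measure_eqI) (auto simp: s)
  next
    case False
    define m where "m = measure M1 UNIV"
    have mpos: "m > 0" using False by (simp add: m_def order_less_le)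
    have m2: "measure M2 UNIV = m" using m by (simp add: m_def)
    have dist: "real_distribution (density M (\<lambda>_. ennreal (1 / m)))" and
      ch: "char (density M (\<lambda>_. ennreal (1 / m))) t = char M t / m"
      if "finite_measure M" "sets M = sets borel" "measure M UNIV = m" for M :: "real measure" and t
    proof -
      interpret M: finite_measure M by fact
      note [measurable_cong] = that(2)
      have sp: "space M = UNIV" using sets_eq_imp_space_eq[OF that(2)] by simp
      have "ennreal (1 / m) * ennreal m = 1" using mpos by (simp flip: ennreal_mult)
      then show "real_distribution (density M (\<lambda>_. ennreal (1 / m)))"
        by (intro real_distribution.intro real_distribution_axioms.intro prob_spaceI)
          (simp_all add: emeasure_density_const sp M.emeasure_eq_measure that)
      have "char (density M (\<lambda>_. ennreal (1 / m))) t = (1 / m) *\<^sub>R char M t"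
        unfolding char_def using mpos by (subst integral_density) (simp_all add: that)
      then show "char (density M (\<lambda>_. ennreal (1 / m))) t = char M t / m"
        by (simp add: scaleR_conv_of_real)
    qed
    have eq: "density M1 (\<lambda>_. ennreal (1 / m)) = density M2 (\<lambda>_. ennreal (1 / m))"
      by (rule Levy_uniqueness) (use dist ch assms m2 in \<open>auto simp: m_def fun_eq_iff\<close>)
    have "emeasure M1 A = emeasure M2 A" if "A \<in> sets borel" for A
    proof -
      have "ennreal m * (ennreal (1 / m) * emeasure M1 A) = ennreal m * (ennreal (1 / m) * emeasure M2 A)"
        using arg_cong[OF eq, of "\<lambda>M. emeasure M A"] that by (simp add: emeasure_density_const s)
      moreover have "ennreal m * ennreal (1 / m) = 1" using mpos by (simp flip: ennreal_mult)
      ultimately show ?thesis by (simp flip: mult.assoc)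
    qed
    then show ?thesis by (intro measure_eqI) (auto simp: s)
  qed
qed

lemma integral_eq_0_if_Re_Im_eq_0:
  fixes w :: "'a \<Rightarrow> complex"
  assumes "integrable M w" "(LINT u|M. Re (w u)) = 0" "(LINT u|M. Im (w u)) = 0"
  shows "(LINT u|M. w u) = 0"
  using assms by (simp add: complex_eq_iff)

lemma integrable_mult_bounded:
  fixes w g :: "'a \<Rightarrow> 'b::{real_normed_field,banach,second_countable_topology}"
  assumes "integrable M w" "g \<in> borel_measurable M" "\<And>u. norm (g u) \<le> C"
  shows "integrable M (\<lambda>u. w u * g u)"
proof (rule Bochner_Integration.integrable_bound)
  show "integrable M (\<lambda>u. C * norm (w u))" using assms by auto
  show "(\<lambda>u. w u * g u) \<in> borel_measurable M" using assms by auto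
  have "norm (w u * g u) \<le> norm (C * norm (w u))" for u
  proof -
    have "0 \<le> C" using assms(3)[of u] norm_ge_zero order_trans by blast
    then show ?thesis using assms(3)[of u] by (simp add: norm_mult mult.commute mult_right_mono)
  qed
  then show "AE u in M. norm (w u * g u) \<le> norm (C * norm (w u))" by simp
qed

text \<open>The positive and the negative part of \<open>w\<close> have images under
  \<open>Y\<close> with equal characteristic functions, so a signed weight reduces to a comparison
  of two finite measures.\<close>

lemma real_weight_char_eq_0:
  fixes w Y :: "'a \<Rightarrow> real"
  assumes w: "integrable M w" and Y[measurable]: "Y \<in> borel_measurable M"
    and 0: "\<And>t. (LINT u|M. of_real (w u) * cis (t * Y u)) = 0"
    and B[measurable]: "B \<in> sets borel"
  shows "(LINT u|M. w u * indicator B (Y u)) = 0"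
proof -
  have [measurable]: "w \<in> borel_measurable M" using w by auto
  define m where "m f = distr (density M (\<lambda>u. ennreal (f u))) borel Y" for f
  have fin: "finite_measure (m f)" if "integrable M f" "\<And>u. 0 \<le> f u" for f
  proof (rule finite_measureI)
    have [measurable]: "f \<in> borel_measurable M" using that by auto
    have "emeasure (m f) (space (m f)) = (\<integral>\<^sup>+u. f u \<partial>M)"
      by (simp add: m_def emeasure_distr emeasure_density)
    then show "emeasure (m f) (space (m f)) \<noteq> \<infinity>" using that by (simp add: nn_integral_eq_integral)
  qed
  have char: "char (m f) t = (LINT u|M. of_real (f u) * cis (t * Y u))" 
    if "integrable M f" "\<And>u. 0 \<le> f u" for f t
  proof -
    have [measurable]: "f \<in> borel_measurable M" using that by auto
    show ?thesis unfolding char_def m_def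
      by (subst integral_distr) (use that in \<open>auto simp: integral_density cis_conv_exp scaleR_conv_of_real\<close>)
  qed
  have meas: "measure (m f) B = (LINT u|M. f u * indicator B (Y u))" if "integrable M f" "\<And>u. 0 \<le> f u" for f
  proof -
    have [measurable]: "f \<in> borel_measurable M" using that by auto
    have "measure (m f) B = (LINT y|m f. indicator B y)" by (simp add: m_def)
    also have "\<dots> = (LINT u|M. f u * indicator B (Y u))"
      unfolding m_def by (subst integral_distr) (use that in \<open>auto simp: integral_density\<close>)
    finally show ?thesis .
  qed
  define p n where "p u = max 0 (w u)" and "n u = max 0 (- w u)" for u
  have pn: "integrable M p" "integrable M n" unfolding p_def[abs_def] n_def[abs_def] using w by auto
  have nonneg: "0 \<le> p u" "0 \<le> n u" and wpn: "w u = p u - n u" for u by (auto simp: p_def n_def)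
  have [measurable]: "p \<in> borel_measurable M" "n \<in> borel_measurable M" using pn by auto
  have "m p = m n"
  proof (rule finite_measure_eq_if_char_eq)
    fix t
    have "integrable M (\<lambda>u. of_real (p u) * cis (t * Y u))" "integrable M (\<lambda>u. of_real (n u) * cis (t * Y u))"
      using pn by (auto intro!: integrable_mult_bounded[where C=1] simp: cis_conv_exp)
    with 0[of t] show "char (m p) t = char (m n) t"
      by (simp add: char pn nonneg wpn left_diff_distrib)
  qed (use fin pn nonneg in \<open>auto simp: m_def\<close>)
  moreover have "integrable M (\<lambda>u. p u * indicator B (Y u))" "integrable M (\<lambda>u. n u * indicator B (Y u))"
    using pn by (auto intro!: integrable_mult_bounded[where C=1] simp: indicator_def)
  ultimately show ?thesis using meas[of p] meas[of n] pn nonneg by (simp add: wpn left_diff_distrib)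
qed

lemma complex_weight_char_eq_0:
  fixes w :: "'a \<Rightarrow> complex" and Y :: "'a \<Rightarrow> real"
  assumes w: "integrable M w" and Y[measurable]: "Y \<in> borel_measurable M"
    and 0: "\<And>t. (LINT u|M. w u * cis (t * Y u)) = 0"
    and B[measurable]: "B \<in> sets borel"
  shows "(LINT u|M. w u * indicator B (Y u)) = 0"
proof -
  have [measurable]: "w \<in> borel_measurable M" using w by auto
  have i: "integrable M (\<lambda>u. w u * cis (t * Y u))" "integrable M (\<lambda>u. cnj (w u) * cis (t * Y u))" for t
    using w by (auto intro!: integrable_mult_bounded[where C=1] simp: cis_conv_exp)
  \<comment> \<open>The transform of \<open>cnj w\<close> at \<open>t\<close> is the conjugate of
    the transform of \<open>w\<close> at \<open>- t\<close>. As both vanish, so do the transforms of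
    the real and the imaginary part.\<close>
  have cnj0: "(LINT u|M. cnj (w u) * cis (t * Y u)) = 0" for t
  proof -
    have "(LINT u|M. cnj (w u) * cis (t * Y u)) = (LINT u|M. cnj (w u * cis (- t * Y u)))"
      by (simp add: cis_cnj)
    also have "\<dots> = cnj (LINT u|M. w u * cis (- t * Y u))" by (rule Bochner_Integration.integral_cnj)
    finally show ?thesis using 0[of "-t"] by simp
  qed
  have "(LINT u|M. of_real (Re (w u)) * cis (t * Y u)) = 0" for t
  proof -
    have "(LINT u|M. of_real (Re (w u)) * cis (t * Y u)) 
      = (LINT u|M. (1/2) * (w u * cis (t * Y u) + cnj (w u) * cis (t * Y u)))"
      by (intro Bochner_Integration.integral_cong refl) (simp add: complex_add_cnj flip: distrib_right)
    also have "\<dots> = 0" using i 0 cnj0 by simp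
    finally show ?thesis .
  qed
  from real_weight_char_eq_0[OF _ Y this B]
  have re: "(LINT u|M. Re (w u) * indicator B (Y u)) = 0" using w by simp
  have "(LINT u|M. of_real (Im (w u)) * cis (t * Y u)) = 0" for t
  proof -
    have "(LINT u|M. of_real (Im (w u)) * cis (t * Y u)) 
      = (LINT u|M. (- \<i>/2) * (w u * cis (t * Y u) - cnj (w u) * cis (t * Y u)))"
      by (intro Bochner_Integration.integral_cong refl) (simp add: complex_eq_iff field_simps)
    also have "\<dots> = 0" using i 0 cnj0 by simp
    finally show ?thesis .
  qed
  from real_weight_char_eq_0[OF _ Y this B]
  have im: "(LINT u|M. Im (w u) * indicator B (Y u)) = 0" using w by simp
  show ?thesis
  proof (rule integral_eq_0_if_Re_Im_eq_0)
    show "integrable M (\<lambda>u. w u * indicator B (Y u))"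
      using w by (auto intro!: integrable_mult_bounded[where C=1] simp: indicator_def)
    have "Re (w u * indicator B (Y u)) = Re (w u) * indicator B (Y u)"
      "Im (w u * indicator B (Y u)) = Im (w u) * indicator B (Y u)" for u by (auto simp: indicator_def)
    with re im show "(LINT u|M. Re (w u * indicator B (Y u))) = 0" "(LINT u|M. Im (w u * indicator B (Y u))) = 0"
      by simp_all
  qed
qed

text \<open>One coordinate at a time, so that one-dimensional uniqueness suffices:
  \<open>cis (t * Y u j)\<close> joins the weight for the induction hypothesis, then the product of
  indicators joins the weight for the coordinate \<open>j\<close>.\<close>

lemma complex_weight_char_eq_0_family:
  fixes w :: "'a \<Rightarrow> complex" and Y :: "'a \<Rightarrow> 'i \<Rightarrow> real"
  assumes "finite I" "integrable M w" "\<And>i. i \<in> I \<Longrightarrow> (\<lambda>u. Y u i) \<in> borel_measurable M"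
    and "\<And>t. (LINT u|M. w u * cis (\<Sum>i\<in>I. t i * Y u i)) = 0"
    and "\<And>i. i \<in> I \<Longrightarrow> B i \<in> sets borel"
  shows "(LINT u|M. w u * (\<Prod>i\<in>I. indicator (B i) (Y u i))) = 0"
  using assms
proof (induction I arbitrary: w rule: finite_induct)
  case empty
  then show ?case by simp
next
  case (insert j I)
  have [measurable]: "(\<lambda>u. Y u i) \<in> borel_measurable M" "B i \<in> sets borel" if "i \<in> insert j I" for i
    using insert.prems that by auto
  have [measurable]: "w \<in> borel_measurable M" using insert.prems by auto
  have [measurable]: "(\<lambda>u. \<Prod>i\<in>I. indicator (B i) (Y u i) :: complex) \<in> borel_measurable M"
  proof (rule borel_measurable_prod)
    fix i assume "i \<in> I"
    then have [measurable]: "(\<lambda>u. Y u i) \<in> borel_measurable M" "B i \<in> sets borel"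
      using insert.prems by auto
    show "(\<lambda>u. indicator (B i) (Y u i) :: complex) \<in> borel_measurable M" by measurable
  qed
  define v where "v u = w u * (\<Prod>i\<in>I. indicator (B i) (Y u i))" for u
  have b: "norm (\<Prod>i\<in>I. indicator (B i) (Y u i) :: complex) \<le> 1" for u
    unfolding prod_norm[symmetric] by (intro prod_le_1) (auto simp: indicator_def)
  have "(LINT u|M. v u * indicator (B j) (Y u j)) = 0"
  proof (rule complex_weight_char_eq_0)
    show "integrable M v" unfolding v_def[abs_def]
      using insert.prems b by (intro integrable_mult_bounded[where C=1]) auto
    fix t
    have "(LINT u|M. (w u * cis (t * Y u j)) * (\<Prod>i\<in>I. indicator (B i) (Y u i))) = 0"
    proof (rule insert.IH)
      have "(\<lambda>u. cis (t * Y u j)) \<in> borel_measurable M" unfolding cis_conv_exp by measurable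
      then show "integrable M (\<lambda>u. w u * cis (t * Y u j))"
        using insert.prems by (intro integrable_mult_bounded[where C=1]) auto
      fix s
      have "(LINT u|M. w u * cis (\<Sum>i\<in>insert j I. (s(j := t)) i * Y u i)) = 0"
        by (rule insert.prems)
      moreover have "(\<Sum>i\<in>insert j I. (s(j := t)) i * Y u i) = t * Y u j + (\<Sum>i\<in>I. s i * Y u i)" for u
      proof -
        have "(\<Sum>i\<in>I. (s(j := t)) i * Y u i) = (\<Sum>i\<in>I. s i * Y u i)"
          using insert.hyps by (intro sum.cong) auto
        then show ?thesis using insert.hyps by simp
      qed
      ultimately show "(LINT u|M. w u * cis (t * Y u j) * cis (\<Sum>i\<in>I. s i * Y u i)) = 0"
        by (simp add: mult.assoc cis_mult)
    qed (use insert.prems in auto)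
    then show "(LINT u|M. v u * cis (t * Y u j)) = 0" by (simp add: v_def mult_ac)
  qed auto
  then show ?case using insert.hyps by (simp add: v_def mult_ac)
qed

lemma borel_measurable_vec_nth [measurable]: "(\<lambda>x::real^'n. x $ i) \<in> borel_measurable borel"
  by (intro borel_measurable_continuous_onI continuous_intros)

text \<open>Boxes are an intersection-stable generator of the Borel sets. Frequency 0 gives total
  mass 0, hence complements; dominated convergence gives countable disjoint unions.\<close>

lemma complex_weight_char_eq_0_vec:
  fixes w :: "'a \<Rightarrow> complex" and Y :: "'a \<Rightarrow> real^'n"
  assumes w: "integrable M w" and Y[measurable]: "Y \<in> borel_measurable M"
    and 0: "\<And>\<xi>. (LINT u|M. w u * cis (\<xi> \<bullet> Y u)) = 0"
    and B: "B \<in> sets borel"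
  shows "(LINT u|M. w u * indicator B (Y u)) = 0"
proof -
  have [measurable]: "w \<in> borel_measurable M" using w by auto
  have int: "integrable M (\<lambda>u. w u * indicator B (Y u))" if [measurable]: "B \<in> sets borel" for B
    using w by (intro integrable_mult_bounded[where C=1]) (auto simp: indicator_def)
  have box: "(LINT u|M. w u * indicator (box a b) (Y u)) = 0" for a b
  proof -
    have "(LINT u|M. w u * (\<Prod>i\<in>UNIV. indicator {a $ i<..<b $ i} (Y u $ i))) = 0"
    proof (rule complex_weight_char_eq_0_family)
      fix t :: "'n \<Rightarrow> real"
      show "(LINT u|M. w u * cis (\<Sum>i\<in>UNIV. t i * Y u $ i)) = 0"
        using 0[of "\<chi> i. t i"] by (simp add: inner_vec_def)
    qed (use w in auto)
    moreover have "(\<Prod>i\<in>UNIV. indicator {a $ i<..<b $ i} (y $ i)) = (indicator (box a b) y :: complex)" for y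
      by (auto simp: indicator_def mem_box_cart)
    ultimately show ?thesis by simp
  qed
  have tot: "(LINT u|M. w u) = 0" using 0[of 0] by simp
  have "Int_stable (range (\<lambda>(a, b). box a b :: (real^'n) set))"
    by (auto simp: Int_stable_def box_Int_box)
  moreover have "range (\<lambda>(a, b). box a b :: (real^'n) set) \<subseteq> Pow UNIV" by simp
  moreover have "B \<in> sigma_sets UNIV (range (\<lambda>(a, b). box a b))"
    using B unfolding borel_eq_box by simp
  ultimately show ?thesis
  proof (induction rule: sigma_sets_induct_disjoint)
    case (basic A) then show ?case using box by auto
  next
    case empty show ?case by simp
  next
    case (compl A)
    then have A: "A \<in> sets borel" unfolding borel_eq_box by simp
    have "(LINT u|M. w u * indicator (UNIV - A) (Y u)) = (LINT u|M. w u - w u * indicator A (Y u))"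
      by (intro Bochner_Integration.integral_cong) (auto simp: indicator_def)
    then show ?case using int[OF A] w compl tot by simp
  next
    case (union A)
    then have A: "A i \<in> sets borel" for i unfolding borel_eq_box by (auto simp: image_subset_iff)
    then have A': "(\<Union>i. A i) \<in> sets borel" by auto
    have "(\<lambda>k. LINT u|M. (\<Sum>i<k. w u * indicator (A i) (Y u))) \<longlonglongrightarrow> (LINT u|M. w u * indicator (\<Union>i. A i) (Y u))"
    proof (rule integral_dominated_convergence[where w="\<lambda>u. norm (w u)"])
      have dis: "(\<Sum>i<k. w u * indicator (A i) (Y u)) = w u * indicator (\<Union>i<k. A i) (Y u)" for u k
        by (subst indicator_UN_disjoint)
          (use union(1) in \<open>auto simp: disjoint_family_on_def sum_distrib_left\<close>)
      show "AE u in M. norm (\<Sum>i<k. w u * indicator (A i) (Y u)) \<le> norm (w u)" for k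
        unfolding dis by (auto simp: indicator_def)
      show "AE u in M. (\<lambda>k. \<Sum>i<k. w u * indicator (A i) (Y u)) \<longlonglongrightarrow> w u * indicator (\<Union>i. A i) (Y u)"
        unfolding dis by (intro AE_I2 tendsto_mult tendsto_const LIMSEQ_indicator_UN)
      show "(\<lambda>u. w u * indicator (\<Union>i. A i) (Y u)) \<in> borel_measurable M" using A' by measurable
    qed (use A w in auto)
    moreover have "(LINT u|M. (\<Sum>i<k. w u * indicator (A i) (Y u))) = 0" for k
      by (subst Bochner_Integration.integral_sum) (use int A union in auto)
    ultimately show ?case by (simp add: LIMSEQ_const_iff)
  qed
qed

text \<open>Passing from indicators to general \<open>g\<close> by comparing the images of the positive and the
  negative part of the weight.\<close>

lemma real_weight_eq_0:
  fixes w :: "'a \<Rightarrow> real" and Y :: "'a \<Rightarrow> real^'n" and g :: "real^'n \<Rightarrow> complex"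
  assumes w: "integrable M w" and Y[measurable]: "Y \<in> borel_measurable M"
    and 0: "\<And>B. B \<in> sets borel \<Longrightarrow> (LINT u|M. w u * indicator B (Y u)) = 0"
    and g[measurable]: "g \<in> borel_measurable borel" and int: "integrable M (\<lambda>u. w u *\<^sub>R g (Y u))"
  shows "(LINT u|M. w u *\<^sub>R g (Y u)) = 0"
proof -
  have [measurable]: "w \<in> borel_measurable M" using w by auto
  define m where "m f = distr (density M (\<lambda>u. ennreal (f u))) borel Y" for f
  define p n where "p u = max 0 (w u)" and "n u = max 0 (- w u)" for u
  have pn: "integrable M p" "integrable M n" unfolding p_def[abs_def] n_def[abs_def] using w by auto
  have nonneg: "0 \<le> p u" "0 \<le> n u" and wpn: "w u = p u - n u" for u by (auto simp: p_def n_def)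
  have [measurable]: "p \<in> borel_measurable M" "n \<in> borel_measurable M" using pn by auto
  have "m p = m n"
  proof (rule measure_eqI)
    fix B assume "B \<in> sets (m p)"
    then have [measurable]: "B \<in> sets borel" by (simp add: m_def)
    have i: "integrable M (\<lambda>u. p u * indicator B (Y u))" "integrable M (\<lambda>u. n u * indicator B (Y u))"
      using pn by (auto intro!: integrable_mult_bounded[where C=1] simp: indicator_def)
    have em: "emeasure (m f) B = ennreal (LINT u|M. f u * indicator B (Y u))"
      if [measurable]: "f \<in> borel_measurable M" and "\<And>u. 0 \<le> f u" "integrable M (\<lambda>u. f u * indicator B (Y u))" for f
    proof -
      have "emeasure (m f) B = (\<integral>\<^sup>+u. ennreal (f u * indicator B (Y u)) \<partial>M)"
        by (simp add: m_def emeasure_distr emeasure_density)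
          (intro nn_integral_cong, simp add: indicator_def)
      then show ?thesis using that by (simp add: nn_integral_eq_integral)
    qed
    have "(LINT u|M. p u * indicator B (Y u)) = (LINT u|M. n u * indicator B (Y u))"
      using 0[of B] i by (simp add: wpn left_diff_distrib)
    then show "emeasure (m p) B = emeasure (m n) B" using i nonneg by (simp add: em)
  qed (simp add: m_def)
  have L: "integral\<^sup>L (m f) g = (LINT u|M. f u *\<^sub>R g (Y u))"
    if [measurable]: "f \<in> borel_measurable M" and "\<And>u. 0 \<le> f u" for f
    unfolding m_def by (subst integral_distr) (use that in \<open>auto simp: integral_density\<close>)
  have eq: "(LINT u|M. p u *\<^sub>R g (Y u)) = (LINT u|M. n u *\<^sub>R g (Y u))"
    using L[of p] L[of n] nonneg \<open>m p = m n\<close> by simp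
  have "integrable M (\<lambda>u. p u *\<^sub>R g (Y u))" "integrable M (\<lambda>u. n u *\<^sub>R g (Y u))"
    using nonneg by (auto intro!: Bochner_Integration.integrable_bound[OF int] mult_right_mono AE_I2 simp: p_def n_def)
  then show ?thesis using eq by (simp add: wpn scaleR_left_diff_distrib)
qed

text \<open>Here \<open>g\<close> may be unbounded, since it will carry an \<open>L^p\<close>
  function along the dilation orbit of a point. If the integrand is not integrable, the Bochner
  integral is 0 by convention.\<close>

lemma complex_weight_eq_0:
  fixes w :: "'a \<Rightarrow> complex" and Y :: "'a \<Rightarrow> real^'n" and g :: "real^'n \<Rightarrow> complex"
  assumes w: "integrable M w" and Y[measurable]: "Y \<in> borel_measurable M"
    and 0: "\<And>\<xi>. (LINT u|M. w u * cis (\<xi> \<bullet> Y u)) = 0"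
    and g[measurable]: "g \<in> borel_measurable borel"
  shows "(LINT u|M. w u * g (Y u)) = 0"
proof (cases "integrable M (\<lambda>u. w u * g (Y u))")
  case True
  have [measurable]: "w \<in> borel_measurable M" using w by auto
  have re: "(LINT u|M. Re (w u) * indicator B (Y u)) = 0" and im: "(LINT u|M. Im (w u) * indicator B (Y u)) = 0"
    if [measurable]: "B \<in> sets borel" for B
  proof -
    have "(LINT u|M. w u * indicator B (Y u)) = 0"
      by (rule complex_weight_char_eq_0_vec[OF w Y 0 that])
    moreover have "integrable M (\<lambda>u. w u * indicator B (Y u))"
      using w by (intro integrable_mult_bounded[where C=1]) (auto simp: indicator_def)
    ultimately have "(LINT u|M. Re (w u * indicator B (Y u))) = 0" "(LINT u|M. Im (w u * indicator B (Y u))) = 0"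
      by (simp_all only: integral_Re integral_Im zero_complex.sel)
    moreover have "Re (w u * indicator B (Y u)) = Re (w u) * indicator B (Y u)"
      "Im (w u * indicator B (Y u)) = Im (w u) * indicator B (Y u)" for u by (auto simp: indicator_def)
    ultimately show "(LINT u|M. Re (w u) * indicator B (Y u)) = 0" "(LINT u|M. Im (w u) * indicator B (Y u)) = 0"
      by simp_all
  qed
  have i: "integrable M (\<lambda>u. Re (w u) *\<^sub>R g (Y u))" "integrable M (\<lambda>u. Im (w u) *\<^sub>R g (Y u))"
    using abs_Re_le_cmod abs_Im_le_cmod
    by (auto intro!: Bochner_Integration.integrable_bound[OF True] mult_right_mono AE_I2 simp: norm_mult)
  have "(LINT u|M. w u * g (Y u)) = (LINT u|M. Re (w u) *\<^sub>R g (Y u) + \<i> * (Im (w u) *\<^sub>R g (Y u)))"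
    by (intro Bochner_Integration.integral_cong refl) (simp add: complex_eq_iff)
  also have "\<dots> = (LINT u|M. Re (w u) *\<^sub>R g (Y u)) + \<i> * (LINT u|M. Im (w u) *\<^sub>R g (Y u))"
    using i by (simp del: mult_scaleR_right)
  also have "\<dots> = 0"
    using real_weight_eq_0[OF _ Y re g i(1)] real_weight_eq_0[OF _ Y im g i(2)] w by simp
  finally show ?thesis .
qed (simp add: not_integrable_integral_eq)

section \<open>Logarithmic coordinates\<close>

lemma borel_measurable_vecI:
  fixes f :: "'a \<Rightarrow> real^'n"
  assumes "\<And>i. (\<lambda>u. f u $ i) \<in> borel_measurable M"
  shows "f \<in> borel_measurable M"
  unfolding borel_measurable_euclidean_space[of f]
  using assms by (auto simp: Basis_vec_def inner_axis)

lemma borel_measurable_matrix_vector_mult [measurable (raw)]: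
  fixes B :: "real^'n^'m"
  assumes [measurable]: "f \<in> borel_measurable M"
  shows "(\<lambda>u. B *v f u) \<in> borel_measurable M"
proof (rule measurable_compose[OF assms])
  show "(*v) B \<in> borel_measurable borel"
    by (intro borel_measurable_continuous_onI linear_continuous_on matrix_vector_mul_bounded_linear)
qed

lemma Basis_vec_real: "(Basis :: (real^'n) set) = range (\<lambda>i. axis i 1)"
  by (auto simp: Basis_vec_def)

lemma inj_axis_1: "inj (\<lambda>i. axis i (1::real) :: real^'n)"
  by (auto simp: inj_def axis_eq_axis)

text \<open>The logarithm of the determinant of the diagonal matrix with entries
  \<open>exp (l $ i)\<close>.\<close>

definition coord_sum :: "real^'n \<Rightarrow> real" where
  "coord_sum l = (\<Sum>i\<in>UNIV. l $ i)"

lemma coord_sum_add: "coord_sum (k + l) = coord_sum k + coord_sum l"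
  by (simp add: coord_sum_def sum.distrib)

lemma coord_sum_measurable [measurable]: "coord_sum \<in> borel_measurable borel"
  unfolding coord_sum_def[abs_def] by measurable

lemma nn_integral_diagonal_scaling:
  fixes l :: "real^'n"
  assumes [measurable]: "g \<in> borel_measurable borel"
  shows "(\<integral>\<^sup>+y. g (\<chi> i. exp (l $ i) * y $ i) \<partial>lborel) * ennreal (exp (coord_sum l)) = (\<integral>\<^sup>+y. g y \<partial>lborel)"
proof -
  let ?T = "\<lambda>x::real^'n. 0 + (\<Sum>j\<in>Basis. (exp (l \<bullet> j) * (x \<bullet> j)) *\<^sub>R j)"
  have T: "?T x = (\<chi> i. exp (l $ i) * x $ i)" for x
  proof (rule euclidean_eqI)
    fix b :: "real^'n" assume "b \<in> Basis"
    then have "?T x \<bullet> b = exp (l \<bullet> b) * (x \<bullet> b)" by simp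
    then show "?T x \<bullet> b = (\<chi> i. exp (l $ i) * x $ i) \<bullet> b"
      using \<open>b \<in> Basis\<close> by (auto simp: Basis_vec_real inner_axis)
  qed
  have [measurable]: "(\<lambda>x::real^'n. \<chi> i. exp (l $ i) * x $ i) \<in> borel_measurable borel"
    by (rule borel_measurable_vecI) simp
  have prod: "(\<Prod>j\<in>Basis. \<bar>exp (l \<bullet> j)\<bar>) = exp (coord_sum l)"
    by (simp add: Basis_vec_real prod.reindex[OF inj_axis_1] coord_sum_def exp_sum inner_axis)
  have "(\<integral>\<^sup>+y. g y \<partial>lborel) = (\<integral>\<^sup>+y. g y \<partial>density (distr lborel borel ?T) (\<lambda>_. (\<Prod>j\<in>Basis. \<bar>exp (l \<bullet> j)\<bar>)))"
    by (subst lborel_affine_euclidean[of "\<lambda>j. exp (l \<bullet> j)" 0]) auto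
  also have "\<dots> = ennreal (exp (coord_sum l)) * (\<integral>\<^sup>+y. g (\<chi> i. exp (l $ i) * y $ i) \<partial>lborel)"
    unfolding T prod by (simp add: nn_integral_density nn_integral_distr nn_integral_cmult)
  finally show ?thesis by (simp add: mult.commute)
qed

text \<open>On the positive half-line, \<open>dt / t\<close> is Lebesgue measure in the coordinate
  \<open>ln t\<close>.\<close>

lemma nn_integral_reciprocal:
  fixes a b :: real
  assumes "a \<le> b"
  shows "(\<integral>\<^sup>+t. ennreal (indicator {exp a..exp b} t / t) \<partial>lborel) = ennreal (b - a)"
proof -
  have "(\<integral>\<^sup>+t. ennreal (1 / t) * indicator {exp a..exp b} t \<partial>lborel) = ennreal (ln (exp b) - ln (exp a))"
  proof (rule nn_integral_FTC_Icc)
    fix t assume t: "t \<in> {exp a..exp b}"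
    then have "0 < t" using exp_gt_zero[of a] by (auto simp del: exp_gt_zero)
    then show "(ln has_real_derivative 1 / t) (at t)" "0 \<le> 1 / t"
      by (auto intro!: derivative_eq_intros)
  qed (use assms in auto)
  moreover have "ennreal (indicator {exp a..exp b} t / t) = ennreal (1 / t) * indicator {exp a..exp b} t" for t
    by (auto simp: indicator_def)
  ultimately show ?thesis by simp
qed

section \<open>Dilations and cubes attached to an orthonormal eigenbasis\<close>

locale log_coordinates =
  fixes Q :: "real^'n^'n"
  assumes Q: "orthogonal_matrix Q"
begin

definition orthant :: "(real^'n) set" where
  "orthant = {x. \<forall>i. 0 < (Q *v x) $ i}"

definition logc :: "real^'n \<Rightarrow> real^'n" where
  "logc x = (\<chi> i. ln ((Q *v x) $ i))"

text \<open>The matrix \<open>transpose Q ** D ** Q\<close> with \<open>D\<close> diagonal with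
  entries \<open>exp (l $ i)\<close>; on \<open>orthant\<close> it acts as translation by
  \<open>l\<close> in the coordinates \<open>logc\<close>.\<close>

definition dil :: "real^'n \<Rightarrow> real^'n \<Rightarrow> real^'n" where
  "dil l x = transpose Q *v (\<chi> i. exp (l $ i) * (Q *v x) $ i)"

text \<open>Membership in \<open>orthant\<close> is required explicitly because \<open>ln\<close>
  has no geometric meaning at nonpositive arguments.\<close>

definition cube :: "real^'n \<Rightarrow> real \<Rightarrow> (real^'n) set" where
  "cube c r = {x \<in> orthant. \<forall>i. c $ i \<le> logc x $ i \<and> logc x $ i \<le> c $ i + r}"

lemma Q_Qt: "Q *v (transpose Q *v x) = x" and Qt_Q: "transpose Q *v (Q *v x) = x"
  using Q by (simp_all add: matrix_vector_mul_assoc orthogonal_matrix_def del: transpose_matrix_vector)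

lemma orthant_measurable [measurable]: "orthant \<in> sets borel"
  unfolding orthant_def by measurable

lemma logc_measurable [measurable]: "logc \<in> borel_measurable borel"
  unfolding logc_def[abs_def] by (rule borel_measurable_vecI) simp

lemma cube_measurable [measurable]: "cube c r \<in> sets borel"
  unfolding cube_def by measurable

lemma dil_measurable [measurable (raw)]:
  assumes [measurable]: "l \<in> borel_measurable M" "f \<in> borel_measurable M"
  shows "(\<lambda>u. dil (l u) (f u)) \<in> borel_measurable M"
  unfolding dil_def by (intro borel_measurable_matrix_vector_mult borel_measurable_vecI) simp

lemma Q_dil: "(Q *v dil l x) $ i = exp (l $ i) * (Q *v x) $ i"
  by (simp add: dil_def Q_Qt del: transpose_matrix_vector)

lemma dil_in_orthant_iff: "dil l x \<in> orthant \<longleftrightarrow> x \<in> orthant"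
  by (simp add: orthant_def Q_dil zero_less_mult_iff)

lemma logc_dil: "x \<in> orthant \<Longrightarrow> logc (dil l x) = logc x + l"
  by (simp add: logc_def vec_eq_iff Q_dil orthant_def ln_mult less_imp_neq[symmetric])

lemma nn_integral_Q:
  assumes [measurable]: "g \<in> borel_measurable borel"
  shows "(\<integral>\<^sup>+x. g (Q *v x) \<partial>lborel) = (\<integral>\<^sup>+x. g x \<partial>lborel)"
    and "(\<integral>\<^sup>+x. g (transpose Q *v x) \<partial>lborel) = (\<integral>\<^sup>+x. g x \<partial>lborel)"
  using Q by (auto intro!: nn_integral_lborel_orthogonal
    simp: orthogonal_transformation_matrix orthogonal_matrix_transpose simp del: transpose_matrix_vector)

lemma nn_integral_dil:
  assumes [measurable]: "g \<in> borel_measurable borel"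
  shows "ennreal (exp (coord_sum l)) * (\<integral>\<^sup>+x. g (dil l x) \<partial>lborel) = (\<integral>\<^sup>+x. g x \<partial>lborel)"
proof -
  define k where "k y = g (transpose Q *v y)" for y
  have [measurable]: "k \<in> borel_measurable borel" unfolding k_def[abs_def] by measurable
  have m: "(\<lambda>x::real^'n. \<chi> i. exp (l $ i) * x $ i) \<in> borel_measurable borel"
    by (rule borel_measurable_vecI) simp
  have "(\<integral>\<^sup>+x. g (dil l x) \<partial>lborel) = (\<integral>\<^sup>+x. k (\<chi> i. exp (l $ i) * (Q *v x) $ i) \<partial>lborel)"
    by (simp add: k_def dil_def)
  also have "\<dots> = (\<integral>\<^sup>+y. k (\<chi> i. exp (l $ i) * y $ i) \<partial>lborel)"
    using m by (intro nn_integral_Q(1)[where g="\<lambda>y. k (\<chi> i. exp (l $ i) * y $ i)"]) measurable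
  finally have "ennreal (exp (coord_sum l)) * (\<integral>\<^sup>+x. g (dil l x) \<partial>lborel) = (\<integral>\<^sup>+y. k y \<partial>lborel)"
    using nn_integral_diagonal_scaling[of k l] by (simp add: mult.commute)
  also have "\<dots> = (\<integral>\<^sup>+x. g x \<partial>lborel)" unfolding k_def by (rule nn_integral_Q(2)) measurable
  finally show ?thesis .
qed

text \<open>As an equality of measures, the change of variables passes from nonnegative to complex
  integrands.\<close>

lemma lborel_dil: "lborel = density (distr lborel borel (dil l)) (\<lambda>_. ennreal (exp (coord_sum l)))"
proof (rule measure_eqI)
  fix B assume "B \<in> sets (lborel :: (real^'n) measure)"
  then have [measurable]: "B \<in> sets borel" by simp
  have "emeasure lborel B = (\<integral>\<^sup>+x. indicator B x \<partial>lborel)" by simp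
  also have "\<dots> = ennreal (exp (coord_sum l)) * (\<integral>\<^sup>+x. indicator B (dil l x) \<partial>lborel)"
    by (rule nn_integral_dil[symmetric]) measurable
  also have "\<dots> = emeasure (density (distr lborel borel (dil l)) (\<lambda>_. ennreal (exp (coord_sum l)))) B"
    by (simp add: emeasure_density nn_integral_distr nn_integral_cmult
      del: nn_integral_indicator)
  finally show "emeasure lborel B = emeasure (density (distr lborel borel (dil l)) (\<lambda>_. ennreal (exp (coord_sum l)))) B" .
qed simp

lemma integral_dil:
  fixes g :: "real^'n \<Rightarrow> complex"
  assumes [measurable]: "g \<in> borel_measurable borel"
  shows "exp (coord_sum l) *\<^sub>R (LINT x|lborel. g (dil l x)) = (LINT x|lborel. g x)"
proof -
  have "(LINT x|lborel. g x) = (LINT x|density (distr lborel borel (dil l)) (\<lambda>_. ennreal (exp (coord_sum l))). g x)"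
    by (subst lborel_dil[of l]) simp
  also have "\<dots> = exp (coord_sum l) *\<^sub>R (LINT x|lborel. g (dil l x))"
    by (simp add: integral_density integral_distr)
  finally show ?thesis by simp
qed

text \<open>The density is the reciprocal of the product of the coordinates of
  \<open>Q *v x\<close>. It turns Lebesgue measure on the orthant into Lebesgue measure in the
  coordinates \<open>logc\<close>, so the integral is a product of integrals of
  \<open>dt / t\<close>.\<close>

lemma nn_integral_cube:
  assumes "0 \<le> r"
  shows "(\<integral>\<^sup>+x. ennreal (indicator (cube c r) x * exp (- coord_sum (logc x))) \<partial>lborel) = ennreal (r ^ CARD('n))"
proof -
  define f where "f b t = ennreal (indicator {exp (c \<bullet> b)..exp (c \<bullet> b + r)} t / t)" for b t
  have "(\<integral>\<^sup>+x. ennreal (indicator (cube c r) x * exp (- coord_sum (logc x))) \<partial>lborel)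
    = (\<integral>\<^sup>+x. (\<Prod>b\<in>Basis. f b ((Q *v x) \<bullet> b)) \<partial>lborel)"
  proof (rule nn_integral_cong)
    fix x
    have pos: "0 < t" if "exp a \<le> t" for a t :: real using that exp_gt_zero[of a] by linarith
    have eq: "indicator {exp a..exp b} t / t = (if 0 < t \<and> a \<le> ln t \<and> ln t \<le> b then exp (- ln t) else 0)" for a b t :: real
    proof (cases "0 < t")
      case True
      then show ?thesis by (auto simp: indicator_def ln_ge_iff ln_le_cancel_iff exp_minus inverse_eq_divide)
          (metis exp_le_cancel_iff exp_ln ln_ge_iff)+
    next
      case False
      then show ?thesis using pos[of a t] by (auto simp: indicator_def)
    qed
    have "(\<Prod>b\<in>Basis. f b ((Q *v x) \<bullet> b)) = (\<Prod>i\<in>UNIV. f (axis i 1) ((Q *v x) $ i))"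
      by (simp add: Basis_vec_real prod.reindex[OF inj_axis_1] inner_axis)
    also have "\<dots> = ennreal (\<Prod>i\<in>UNIV. if 0 < (Q *v x) $ i \<and> c $ i \<le> ln ((Q *v x) $ i) \<and> ln ((Q *v x) $ i) \<le> c $ i + r
        then exp (- ln ((Q *v x) $ i)) else 0)"
      unfolding f_def eq inner_axis by (subst prod_ennreal) auto
    also have "\<dots> = ennreal (indicator (cube c r) x * exp (- coord_sum (logc x)))"
    proof (cases "x \<in> cube c r")
      case True
      then show ?thesis
        by (auto simp: cube_def orthant_def logc_def coord_sum_def exp_sum simp flip: sum_negf)
    next
      case False
      then obtain i where "\<not> (0 < (Q *v x) $ i \<and> c $ i \<le> ln ((Q *v x) $ i) \<and> ln ((Q *v x) $ i) \<le> c $ i + r)"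
        by (auto simp: cube_def orthant_def logc_def)
      then have "(\<Prod>i\<in>UNIV. if 0 < (Q *v x) $ i \<and> c $ i \<le> ln ((Q *v x) $ i) \<and> ln ((Q *v x) $ i) \<le> c $ i + r
        then exp (- ln ((Q *v x) $ i)) else 0) = 0"
        by (intro prod_zero) auto
      then show ?thesis using False by (simp only: indicator_simps) simp
    qed
    finally show "ennreal (indicator (cube c r) x * exp (- coord_sum (logc x))) = (\<Prod>b\<in>Basis. f b ((Q *v x) \<bullet> b))" ..
  qed
  also have "\<dots> = (\<integral>\<^sup>+x. (\<Prod>b\<in>Basis. f b (x \<bullet> b)) \<partial>lborel)"
    by (rule nn_integral_Q(1)[where g="\<lambda>x. \<Prod>b\<in>Basis. f b (x \<bullet> b)"]) (unfold f_def, measurable)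
  also have "\<dots> = (\<Prod>b\<in>(Basis :: (real^'n) set). (\<integral>\<^sup>+t. f b t \<partial>lborel))"
    by (rule nn_integral_lborel_prod) (simp_all add: f_def)
  also have "\<dots> = ennreal (r ^ CARD('n))"
    using assms nn_integral_reciprocal by (simp add: f_def ennreal_power)
  finally show ?thesis .
qed

end

section \<open>Windows and test functions\<close>

text \<open>A substitute for Hoelder's inequality that includes \<open>P = 1\<close>: the bound
  \<open>F \<le> 1 + F powr P\<close>, rescaled. The factor \<open>r powr (n / P)\<close> in
  \<open>F\<close> is chosen so that, integrated over a cube of side \<open>r\<close>, both terms in
  the bracket are of order \<open>r powr n\<close>.\<close>

lemma scaled_le_powr_plus_exp:
  fixes a P r s n :: real
  assumes "0 \<le> a" "1 \<le> P" "0 < r"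
  shows "exp ((1 / P - 1) * s) * a \<le> r powr (- n * (1 / P)) * (r powr n * a powr P + exp (- s))"
proof -
  define F where "F = a * exp (s / P) * r powr (n / P)"
  have F: "0 \<le> F" using assms by (simp add: F_def)
  have "F \<le> 1 + F powr P"
  proof (cases "F \<le> 1")
    case True
    then show ?thesis using powr_ge_zero[of F P] by linarith
  next
    case False
    then have "F powr 1 \<le> F powr P" using assms by (intro powr_mono) auto
    then show ?thesis using False by simp
  qed
  also have "F powr P = a powr P * exp s * r powr n"
    using assms by (simp add: F_def powr_mult powr_powr exp_powr_real)
  finally have le: "F * (exp (- s) * r powr (- n / P)) \<le> (1 + a powr P * exp s * r powr n) * (exp (- s) * r powr (- n / P))"
    by (intro mult_right_mono) auto
  have e1: "F * (exp (- s) * r powr (- n / P)) = exp ((1 / P - 1) * s) * a"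
  proof -
    have "F * (exp (- s) * r powr (- n / P)) = a * (exp (s / P) * exp (- s)) * (r powr (n / P) * r powr (- n / P))"
      by (simp add: F_def mult_ac)
    also have "exp (s / P) * exp (- s) = exp ((1 / P - 1) * s)"
      by (simp add: exp_add[symmetric] algebra_simps)
    also have "r powr (n / P) * r powr (- n / P) = 1"
      using assms by (simp add: powr_add[symmetric])
    finally show ?thesis by (simp add: mult.commute)
  qed
  have e2: "(1 + a powr P * exp s * r powr n) * (exp (- s) * r powr (- n / P))
     = r powr (- n / P) * (r powr n * a powr P * (exp s * exp (- s)) + exp (- s))"
    by (simp add: algebra_simps)
  have e3: "exp s * exp (- s) = 1" by (simp add: exp_add[symmetric])
  show ?thesis using le unfolding e1 e2 e3 by simp
qed

definition tent :: "real \<Rightarrow> real" where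
  "tent t = max 0 (1 - \<bar>2 * t - 1\<bar>)"

lemma tent_nonneg: "0 \<le> tent t" and tent_le_1: "tent t \<le> 1"
  and tent_diff: "\<bar>tent s - tent t\<bar> \<le> 2 * \<bar>s - t\<bar>"
  and tent_eq_0: "t < 0 \<or> 1 < t \<Longrightarrow> tent t = 0"
  and tent_ge_half: "1 / 4 \<le> t \<Longrightarrow> t \<le> 3 / 4 \<Longrightarrow> 1 / 2 \<le> tent t"
  by (auto simp: tent_def max_def abs_real_def)

lemma tent_measurable [measurable]: "tent \<in> borel_measurable borel"
  unfolding tent_def[abs_def] by measurable

text \<open>Controls the change of a window of side \<open>r\<close> whose corner moves by
  \<open>l\<close>; the 2 is the Lipschitz constant of \<open>tent\<close>. The cap at 1 makes it
  integrable against any finite measure, whether or not \<open>l\<close> has finite moments.\<close>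

definition displacement :: "real \<Rightarrow> real^'n \<Rightarrow> real" where
  "displacement r l = min 1 (2 / r * (\<Sum>i\<in>UNIV. \<bar>l $ i\<bar>))"

lemma displacement_measurable [measurable]: "displacement r \<in> borel_measurable borel"
  unfolding displacement_def[abs_def] by measurable

lemma displacement_nonneg: "0 < r \<Longrightarrow> 0 \<le> displacement r l" and displacement_le_1: "displacement r l \<le> 1"
  by (auto simp: displacement_def intro!: mult_nonneg_nonneg sum_nonneg divide_nonneg_nonneg)

section \<open>Localised characters in the dual exponent\<close>

context log_coordinates
begin

text \<open>The weight restricted to \<open>cube c r\<close> has norm
  \<open>r powr (CARD('n) * (1 - inv_exp p))\<close> in the dual exponent, which explains the power
  of \<open>r\<close>. One \<open>C\<close> serves cubes of every position and side.\<close>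

lemma Lp_cube_bound:
  assumes p: "1 \<le> p" and f: "f \<in> Lp_space p"
  obtains C where "0 \<le> C"
    "\<And>c r. 0 < r \<Longrightarrow> (\<integral>\<^sup>+x. ennreal (indicator (cube c r) x * exp ((inv_exp p - 1) * coord_sum (logc x)) * norm (f x)) \<partial>lborel)
      \<le> ennreal (C * r powr (CARD('n) * (1 - inv_exp p)))"
proof (cases "p = \<infinity>")
  case True
  have [measurable]: "f \<in> borel_measurable borel" using f by (simp add: Lp_space_def)
  define e where "e = esssup lborel (\<lambda>x. ereal (norm (f x)))"
  define B where "B = max 0 (real_of_ereal e)"
  have "e < \<infinity>" using f True by (simp add: Lp_space_def e_def)
  moreover have "AE x in lborel. ereal (norm (f x)) \<le> e" unfolding e_def by (rule esssup_AE)
  ultimately have AE: "AE x in lborel. norm (f x) \<le> B"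
    by (cases e) (auto simp: B_def)
  show ?thesis
  proof (rule that[of B])
    show "0 \<le> B" by (simp add: B_def)
    fix c and r :: real assume r: "0 < r"
    have "(\<integral>\<^sup>+x. ennreal (indicator (cube c r) x * exp ((inv_exp p - 1) * coord_sum (logc x)) * norm (f x)) \<partial>lborel)
      \<le> (\<integral>\<^sup>+x. ennreal B * ennreal (indicator (cube c r) x * exp (- coord_sum (logc x))) \<partial>lborel)"
    proof (rule nn_integral_mono_AE, use AE in eventually_elim)
      case (elim x)
      have "indicator (cube c r) x * exp (- coord_sum (logc x)) * norm (f x) \<le> indicator (cube c r) x * exp (- coord_sum (logc x)) * B"
        using elim by (intro mult_left_mono) auto
      then show ?case using True \<open>0 \<le> B\<close> by (simp add: inv_exp_def ennreal_leI mult.commute flip: ennreal_mult)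
    qed
    also have "\<dots> = ennreal B * ennreal (r ^ CARD('n))"
      using r by (simp add: nn_integral_cmult nn_integral_cube)
    finally show "(\<integral>\<^sup>+x. ennreal (indicator (cube c r) x * exp ((inv_exp p - 1) * coord_sum (logc x)) * norm (f x)) \<partial>lborel)
      \<le> ennreal (B * r powr (CARD('n) * (1 - inv_exp p)))"
      using True r \<open>0 \<le> B\<close> by (simp add: inv_exp_def powr_realpow ennreal_mult)
  qed
next
  case False
  have [measurable]: "f \<in> borel_measurable borel" using f by (simp add: Lp_space_def)
  define P where "P = enn2real p"
  have "p = ennreal P" using False by (simp add: P_def less_top)
  then have "ennreal 1 \<le> ennreal P" using p by simp
  then have P: "1 \<le> P" by (subst (asm) ennreal_le_iff) (simp_all add: P_def)
  have \<kappa>: "inv_exp p = 1 / P" using False by (simp add: inv_exp_def P_def)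
  have "(\<integral>\<^sup>+x. ennreal (norm (f x) powr P) \<partial>lborel) < \<infinity>" using f False by (simp add: Lp_space_def P_def)
  then obtain I where I: "0 \<le> I" "(\<integral>\<^sup>+x. ennreal (norm (f x) powr P) \<partial>lborel) = ennreal I"
    by (cases "(\<integral>\<^sup>+x. ennreal (norm (f x) powr P) \<partial>lborel)") auto
  let ?n = "real CARD('n)"
  show ?thesis
  proof (rule that[of "I + 1"])
    show "0 \<le> I + 1" using I by simp
    fix c and r :: real assume r: "0 < r"
    let ?k = "r powr (- ?n * (1 / P))"
    have "(\<integral>\<^sup>+x. ennreal (indicator (cube c r) x * exp ((inv_exp p - 1) * coord_sum (logc x)) * norm (f x)) \<partial>lborel)
      \<le> (\<integral>\<^sup>+x. ennreal ?k * (ennreal (r powr ?n) * ennreal (norm (f x) powr P)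
            + ennreal (indicator (cube c r) x * exp (- coord_sum (logc x)))) \<partial>lborel)"
    proof (rule nn_integral_mono)
      fix x
      have "indicator (cube c r) x * exp ((inv_exp p - 1) * coord_sum (logc x)) * norm (f x)
        \<le> ?k * (r powr ?n * norm (f x) powr P + indicator (cube c r) x * exp (- coord_sum (logc x)))"
        using scaled_le_powr_plus_exp[OF norm_ge_zero P r, of "coord_sum (logc x)" "f x" ?n]
        by (auto simp: indicator_def \<kappa>)
      then show "ennreal (indicator (cube c r) x * exp ((inv_exp p - 1) * coord_sum (logc x)) * norm (f x))
        \<le> ennreal ?k * (ennreal (r powr ?n) * ennreal (norm (f x) powr P) + ennreal (indicator (cube c r) x * exp (- coord_sum (logc x))))"
        by (simp add: ennreal_leI flip: ennreal_mult ennreal_plus)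
    qed
    also have "\<dots> = ennreal ?k * (ennreal (r powr ?n) * ennreal I + ennreal (r ^ CARD('n)))"
      using r by (simp add: nn_integral_cmult nn_integral_add I nn_integral_cube)
    also have "\<dots> = ennreal (?k * (r powr ?n * I + r powr ?n))"
      using r I by (simp add: powr_realpow flip: ennreal_mult ennreal_plus)
    also have "?k * (r powr ?n * I + r powr ?n) = (I + 1) * (r powr ?n * ?k)"
      by (simp add: algebra_simps)
    also have "r powr ?n * ?k = r powr (?n * (1 - inv_exp p))"
      by (simp add: \<kappa> powr_add[symmetric] algebra_simps)
    finally show "(\<integral>\<^sup>+x. ennreal (indicator (cube c r) x * exp ((inv_exp p - 1) * coord_sum (logc x)) * norm (f x)) \<partial>lborel)
      \<le> ennreal ((I + 1) * r powr (?n * (1 - inv_exp p)))" .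
  qed
qed

definition window :: "real^'n \<Rightarrow> real \<Rightarrow> real^'n \<Rightarrow> real" where
  "window c r x = (\<Prod>i\<in>UNIV. tent ((logc x $ i - c $ i) / r))"

lemma window_measurable [measurable (raw)]:
  assumes [measurable]: "c \<in> borel_measurable M" "f \<in> borel_measurable M"
  shows "(\<lambda>u. window (c u) r (f u)) \<in> borel_measurable M"
  unfolding window_def[abs_def] by measurable

lemma window_nonneg: "0 \<le> window c r x" and window_le_1: "window c r x \<le> 1"
  by (auto simp: window_def tent_nonneg tent_le_1 intro!: prod_nonneg prod_le_1)

lemma window_eq_0:
  assumes "0 < r" "x \<in> orthant" "x \<notin> cube c r"
  shows "window c r x = 0"
proof -
  obtain i where "logc x $ i < c $ i \<or> c $ i + r < logc x $ i"
    using assms by (auto simp: cube_def not_le)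
  then have "tent ((logc x $ i - c $ i) / r) = 0"
    using assms by (intro tent_eq_0) (auto simp: field_simps)
  then show ?thesis unfolding window_def by (intro prod_zero) auto
qed

lemma window_dil: "x \<in> orthant \<Longrightarrow> window (c + l) r (dil l x) = window c r x"
  by (simp add: window_def logc_dil)

text \<open>Changing the factors of the product one by one costs at most the sum of their
  differences, as all factors lie between 0 and 1. The cap in \<open>displacement\<close> comes from
  the range of the windows.\<close>

lemma window_diff:
  assumes "0 < r"
  shows "\<bar>window (c + l) r x - window c r x\<bar> \<le> displacement r l"
proof -
  have "\<bar>window (c + l) r x - window c r x\<bar>
    \<le> (\<Sum>i\<in>UNIV. norm (tent ((logc x $ i - (c + l) $ i) / r) - tent ((logc x $ i - c $ i) / r)))"
    unfolding window_def real_norm_def[symmetric]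
    by (rule norm_prod_diff) (simp_all add: tent_nonneg tent_le_1)
  also have "\<dots> \<le> (\<Sum>i\<in>UNIV. 2 / r * \<bar>l $ i\<bar>)"
  proof (rule sum_mono)
    fix i
    have "(logc x $ i - (c + l) $ i) / r - (logc x $ i - c $ i) / r = - l $ i / r"
      by (simp add: diff_divide_distrib add_divide_distrib)
    with tent_diff[of "(logc x $ i - (c + l) $ i) / r" "(logc x $ i - c $ i) / r"]
    show "norm (tent ((logc x $ i - (c + l) $ i) / r) - tent ((logc x $ i - c $ i) / r)) \<le> 2 / r * \<bar>l $ i\<bar>"
      using assms by simp
  qed
  finally have "\<bar>window (c + l) r x - window c r x\<bar> \<le> 2 / r * (\<Sum>i\<in>UNIV. \<bar>l $ i\<bar>)"
    by (simp add: sum_distrib_left)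
  moreover have "\<bar>window (c + l) r x - window c r x\<bar> \<le> 1"
    using window_nonneg[of c r x] window_le_1[of c r x] window_nonneg[of "c + l" r x] window_le_1[of "c + l" r x]
    by linarith
  ultimately show ?thesis by (simp add: displacement_def)
qed

text \<open>On the concentric cube of half the side, every argument of \<open>tent\<close> lies
  between 1/4 and 3/4.\<close>

lemma window_lower:
  assumes "0 < r" "x \<in> cube (c + (\<chi> i. r / 4)) (r / 2)"
  shows "(1 / 2) ^ CARD('n) \<le> window c r x"
proof -
  have "(\<Prod>i\<in>(UNIV :: 'n set). 1 / 2) \<le> window c r x"
    unfolding window_def
  proof (rule prod_mono)
    fix i
    have "c $ i + r / 4 \<le> logc x $ i" "logc x $ i \<le> c $ i + r / 4 + r / 2" using assms by (auto simp: cube_def)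
    then have "1 / 4 \<le> (logc x $ i - c $ i) / r" "(logc x $ i - c $ i) / r \<le> 3 / 4"
      using assms by (simp_all add: field_simps)
    then show "0 \<le> (1 / 2 :: real) \<and> 1 / 2 \<le> tent ((logc x $ i - c $ i) / r)" by (intro conjI tent_ge_half) auto
  qed
  then show ?thesis by simp
qed

text \<open>For \<kappa> = 1/p the exponent \<kappa> - 1 is minus the reciprocal of the dual
  exponent: the critical power, for which the dual norm depends on the side \<open>r\<close> but not
  on the corner \<open>c\<close>.\<close>

definition test :: "real \<Rightarrow> real^'n \<Rightarrow> real^'n \<Rightarrow> real \<Rightarrow> real^'n \<Rightarrow> complex" where
  "test \<kappa> \<xi> c r x = of_real (indicator orthant x * exp ((\<kappa> - 1) * coord_sum (logc x)) * window c r x) * cis (- (\<xi> \<bullet> logc x))"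

lemma test_measurable [measurable (raw)]:
  assumes [measurable]: "c \<in> borel_measurable M" "f \<in> borel_measurable M"
  shows "(\<lambda>u. test \<kappa> \<xi> (c u) r (f u)) \<in> borel_measurable M"
  unfolding test_def[abs_def] cis_conv_exp by measurable

lemma norm_test_diff:
  "norm (test \<kappa> \<xi> c r x - test \<kappa> \<xi> d r x)
    = indicator orthant x * exp ((\<kappa> - 1) * coord_sum (logc x)) * \<bar>window c r x - window d r x\<bar>"
proof -
  have "test \<kappa> \<xi> c r x - test \<kappa> \<xi> d r x
    = of_real (indicator orthant x * exp ((\<kappa> - 1) * coord_sum (logc x)) * (window c r x - window d r x)) * cis (- (\<xi> \<bullet> logc x))"
    by (simp add: test_def algebra_simps)
  then show ?thesis by (simp only: norm_mult norm_of_real norm_cis abs_mult) simp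
qed

lemma norm_test_le:
  assumes "0 < r"
  shows "norm (test \<kappa> \<xi> c r x) \<le> indicator (cube c r) x * exp ((\<kappa> - 1) * coord_sum (logc x))"
  using window_eq_0[OF assms, of x c] window_nonneg[of c r x] window_le_1[of c r x]
  by (auto simp: test_def norm_mult indicator_def)

text \<open>The difference lives on the union of two cubes, so both indicators appear; this is the
  source of the factor 2 in the proof of \<open>pairing\<close>.\<close>

lemma norm_test_diff_le:
  assumes "0 < r"
  shows "norm (test \<kappa> \<xi> (c + l) r x - test \<kappa> \<xi> c r x)
    \<le> displacement r l * (indicator (cube (c + l) r) x * exp ((\<kappa> - 1) * coord_sum (logc x))
       + indicator (cube c r) x * exp ((\<kappa> - 1) * coord_sum (logc x)))"
proof (cases "x \<in> cube (c + l) r \<or> x \<in> cube c r")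
  case True
  have "norm (test \<kappa> \<xi> (c + l) r x - test \<kappa> \<xi> c r x) \<le> exp ((\<kappa> - 1) * coord_sum (logc x)) * displacement r l"
    unfolding norm_test_diff using window_diff[OF assms, of c l x] displacement_nonneg[OF assms, of l]
    by (auto simp: indicator_def)
  also have "\<dots> \<le> exp ((\<kappa> - 1) * coord_sum (logc x)) * displacement r l * (indicator (cube (c + l) r) x + indicator (cube c r) x)"
    using True displacement_nonneg[OF assms, of l] by (auto simp: indicator_def)
  finally show ?thesis by (simp add: algebra_simps)
next
  case False
  then show ?thesis unfolding norm_test_diff
    using window_eq_0[OF assms, of x c] window_eq_0[OF assms, of x "c + l"] by (auto simp: indicator_def)
qed

text \<open>The weight in \<open>test\<close> is chosen so that dilating a function is dual to translating the window.\<close>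

lemma test_dil:
  "test \<kappa> \<xi> c r x * exp (\<kappa> * coord_sum l) = exp (coord_sum l) * (cis (\<xi> \<bullet> l) * test \<kappa> \<xi> (c + l) r (dil l x))"
proof (cases "x \<in> orthant")
  case True
  have "exp ((\<kappa> - 1) * coord_sum (logc x)) * exp (\<kappa> * coord_sum l)
    = exp (coord_sum l) * exp ((\<kappa> - 1) * coord_sum (logc x + l))"
    by (simp add: coord_sum_add exp_add[symmetric] algebra_simps)
  then have 1: "complex_of_real (exp ((\<kappa> - 1) * coord_sum (logc x))) * exp (\<kappa> * coord_sum l)
    = exp (coord_sum l) * exp ((\<kappa> - 1) * coord_sum (logc x + l))"
    by (metis of_real_mult)
  have 2: "cis (\<xi> \<bullet> l) * cis (- (\<xi> \<bullet> (logc x + l))) = cis (- (\<xi> \<bullet> logc x))"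
    by (simp add: cis_mult inner_add_right)
  have "test \<kappa> \<xi> c r x * exp (\<kappa> * coord_sum l)
    = (complex_of_real (exp ((\<kappa> - 1) * coord_sum (logc x))) * exp (\<kappa> * coord_sum l)) * window c r x * cis (- (\<xi> \<bullet> logc x))"
    using True by (simp add: test_def mult_ac)
  also have "\<dots> = exp (coord_sum l) * (cis (\<xi> \<bullet> l) * test \<kappa> \<xi> (c + l) r (dil l x))"
    unfolding 1 2[symmetric] using True
    by (simp add: test_def dil_in_orthant_iff logc_dil window_dil mult_ac)
  finally show ?thesis .
qed (simp add: test_def dil_in_orthant_iff)

end

section \<open>Averages of dilations\<close>

text \<open>\<open>N\<close> and \<sigma> play the roles of total variation and phase of a complex
  measure. Finiteness of \<open>N\<close> gives Fubini with Lebesgue measure.\<close>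

locale dilation_average = log_coordinates Q + finite_measure N
  for Q :: "real^'n^'n" and N :: "'a measure" +
  fixes \<sigma> :: "'a \<Rightarrow> complex" and l :: "'a \<Rightarrow> real^'n" and p :: ennreal
  assumes \<sigma>_measurable [measurable]: "\<sigma> \<in> borel_measurable N"
    and norm_\<sigma>_le: "\<And>u. norm (\<sigma> u) \<le> 1"
    and l_measurable [measurable]: "l \<in> borel_measurable N"
    and p_ge_1: "1 \<le> p"
begin

text \<open>The exponential factor makes each weighted dilation an isometry of
  \<open>L^p\<close>.\<close>

definition avg :: "(real^'n \<Rightarrow> complex) \<Rightarrow> real^'n \<Rightarrow> complex" where
  "avg f x = (LINT u|N. \<sigma> u * exp (inv_exp p * coord_sum (l u)) * f (dil (l u) x))"

text \<open>The Fourier transform of the image under \<open>l\<close> of the complex measure with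
  density \<sigma> relative to \<open>N\<close>.\<close>

definition symb :: "real^'n \<Rightarrow> complex" where
  "symb \<xi> = (LINT u|N. \<sigma> u * cis (\<xi> \<bullet> l u))"

lemma cis_l_measurable [measurable]: "(\<lambda>u. cis (\<xi> \<bullet> l u)) \<in> borel_measurable N"
  unfolding cis_conv_exp by measurable

lemma integrable_\<sigma>: "integrable N \<sigma>"
  by (rule integrable_const_bound[of _ 1]) (auto simp: norm_\<sigma>_le)

lemma integrable_\<sigma>_cis: "integrable N (\<lambda>u. \<sigma> u * cis (\<xi> \<bullet> l u))"
  by (rule integrable_const_bound[of _ 1]) (auto simp: norm_mult norm_\<sigma>_le)

lemma displacement_integrable: "0 < r \<Longrightarrow> integrable N (\<lambda>u. displacement r (l u))"
  by (rule integrable_const_bound[of _ 1]) (auto simp: displacement_nonneg displacement_le_1)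

text \<open>Dominated convergence as the side grows, with the cap 1 as majorant.\<close>

lemma displacement_integral_small:
  assumes "0 < e"
  obtains r where "0 < r" "(LINT u|N. displacement r (l u)) < e"
proof -
  have "(\<lambda>k. LINT u|N. displacement (real (Suc k)) (l u)) \<longlonglongrightarrow> (LINT u|N. 0)"
  proof (rule integral_dominated_convergence[where w="\<lambda>_. 1"])
    show "AE u in N. (\<lambda>k. displacement (real (Suc k)) (l u)) \<longlonglongrightarrow> 0"
    proof (rule AE_I2)
      fix u
      have "(\<lambda>k. 2 * (1 / real (Suc k)) * (\<Sum>i\<in>UNIV. \<bar>l u $ i\<bar>)) \<longlonglongrightarrow> 2 * 0 * (\<Sum>i\<in>UNIV. \<bar>l u $ i\<bar>)"
        by (intro tendsto_intros LIMSEQ_Suc[OF lim_1_over_n])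
      then have "(\<lambda>k. 2 / real (Suc k) * (\<Sum>i\<in>UNIV. \<bar>l u $ i\<bar>)) \<longlonglongrightarrow> 0" by simp
      then have "(\<lambda>k. min 1 (2 / real (Suc k) * (\<Sum>i\<in>UNIV. \<bar>l u $ i\<bar>))) \<longlonglongrightarrow> min 1 0"
        by (intro tendsto_min tendsto_const)
      then show "(\<lambda>k. displacement (real (Suc k)) (l u)) \<longlonglongrightarrow> 0" by (simp add: displacement_def)
    qed
    show "AE u in N. norm (displacement (real (Suc k)) (l u)) \<le> 1" for k
      by (rule AE_I2) (simp add: displacement_nonneg displacement_le_1)
  qed auto
  then have "eventually (\<lambda>k. (LINT u|N. displacement (real (Suc k)) (l u)) < e) sequentially"
    using assms by (intro order_tendstoD) auto
  then obtain k where "(LINT u|N. displacement (real (Suc k)) (l u)) < e"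
    by (auto simp: eventually_sequentially)
  then show ?thesis using that[of "real (Suc k)"] by simp
qed

text \<open>Moved onto the test function, the average translates the window by \<open>l u\<close>
  and produces the factor \<open>cis (\<xi> \<bullet> l u)\<close>. If the window stayed in place,
  the result would be exactly \<open>symb \<xi>\<close> times the pairing with \<open>f\<close>; the
  error is bounded by \<open>displacement\<close>. The constant \<open>C\<close> depends on
  \<open>f\<close> but not on the frequency or the cube.\<close>

lemma pairing:
  assumes f: "f \<in> Lp_space p"
  obtains C where "0 \<le> C"
    "\<And>\<xi> c r. 0 < r \<Longrightarrow> integrable lborel (\<lambda>x. test (inv_exp p) \<xi> c r x * f x)"
    "\<And>\<xi> c r. 0 < r \<Longrightarrow> integrable lborel (\<lambda>x. test (inv_exp p) \<xi> c r x * (avg f x - symb \<xi> * f x))"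
    "\<And>\<xi> c r. 0 < r \<Longrightarrow> norm (LINT x|lborel. test (inv_exp p) \<xi> c r x * (avg f x - symb \<xi> * f x))
       \<le> C * r powr (CARD('n) * (1 - inv_exp p)) * (LINT u|N. displacement r (l u))"
proof -
  let ?\<kappa> = "inv_exp p"
  have [measurable]: "f \<in> borel_measurable borel" using f by (simp add: Lp_space_def)
  obtain C where C: "0 \<le> C"
    "\<And>c r. 0 < r \<Longrightarrow> (\<integral>\<^sup>+x. ennreal (indicator (cube c r) x * exp ((?\<kappa> - 1) * coord_sum (logc x)) * norm (f x)) \<partial>lborel)
      \<le> ennreal (C * r powr (CARD('n) * (1 - ?\<kappa>)))"
    using Lp_cube_bound[OF p_ge_1 f] by blast
  have test_bound: "(\<integral>\<^sup>+x. ennreal (norm (test ?\<kappa> \<xi> c r x * f x)) \<partial>lborel) \<le> ennreal (C * r powr (CARD('n) * (1 - ?\<kappa>)))"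
    if r: "0 < r" for \<xi> c r
  proof -
    have "(\<integral>\<^sup>+x. ennreal (norm (test ?\<kappa> \<xi> c r x * f x)) \<partial>lborel)
      \<le> (\<integral>\<^sup>+x. ennreal (indicator (cube c r) x * exp ((?\<kappa> - 1) * coord_sum (logc x)) * norm (f x)) \<partial>lborel)"
      using norm_test_le[OF r] by (intro nn_integral_mono ennreal_leI) (simp add: norm_mult mult_right_mono)
    then show ?thesis using C(2)[OF r, of c] by (rule order_trans)
  qed
  have int_f: "integrable lborel (\<lambda>x. test ?\<kappa> \<xi> c r x * f x)" if r: "0 < r" for \<xi> c r
    using test_bound[OF r, of \<xi> c]
    by (intro integrableI_bounded) (auto simp: le_less_trans[OF _ ennreal_less_top])
  have main: "integrable lborel (\<lambda>x. test ?\<kappa> \<xi> c r x * (avg f x - symb \<xi> * f x)) \<and>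
    norm (LINT x|lborel. test ?\<kappa> \<xi> c r x * (avg f x - symb \<xi> * f x))
       \<le> (2 * C) * r powr (CARD('n) * (1 - ?\<kappa>)) * (LINT u|N. displacement r (l u))"
    if r: "0 < r" for \<xi> c r
  proof -
    define E where "E = C * r powr (CARD('n) * (1 - ?\<kappa>))"
    have E: "0 \<le> E" using C by (simp add: E_def)
    interpret P: pair_sigma_finite N lborel by unfold_locales
    define G where "G u x = test ?\<kappa> \<xi> c r x * (\<sigma> u * exp (?\<kappa> * coord_sum (l u)) * f (dil (l u) x))" for u x
    have G: "G u x = exp (coord_sum (l u)) * (\<sigma> u * cis (\<xi> \<bullet> l u)
        * (test ?\<kappa> \<xi> (c + l u) r (dil (l u) x) * f (dil (l u) x)))" for u x
    proof -
      have "G u x = (test ?\<kappa> \<xi> c r x * exp (?\<kappa> * coord_sum (l u))) * (\<sigma> u * f (dil (l u) x))"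
        by (simp add: G_def mult_ac)
      then show ?thesis unfolding test_dil by (simp add: mult_ac)
    qed
    have [measurable]: "(\<lambda>(u, x). G u x) \<in> borel_measurable (N \<Otimes>\<^sub>M lborel)"
      unfolding G_def by measurable
    have int_G: "integrable (N \<Otimes>\<^sub>M lborel) (\<lambda>(u, x). G u x)"
    proof (rule integrableI_bounded)
      have "(\<integral>\<^sup>+z. ennreal (norm (case z of (u, x) \<Rightarrow> G u x)) \<partial>(N \<Otimes>\<^sub>M lborel)) = (\<integral>\<^sup>+u. (\<integral>\<^sup>+x. ennreal (norm (G u x)) \<partial>lborel) \<partial>N)"
        by (subst lborel.nn_integral_fst[symmetric]) auto
      \<comment> \<open>The bound \<open>E\<close> is the same for all \<open>u\<close>, since a
        dilation only moves the corner of the cube.\<close>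
      also have "\<dots> \<le> (\<integral>\<^sup>+u. ennreal E \<partial>N)"
      proof (rule nn_integral_mono)
        fix u assume "u \<in> space N"
        let ?k = "\<lambda>y. ennreal (norm (test ?\<kappa> \<xi> (c + l u) r y * f y))"
        have "(\<integral>\<^sup>+x. ennreal (norm (G u x)) \<partial>lborel) \<le> (\<integral>\<^sup>+x. ennreal (exp (coord_sum (l u))) * ?k (dil (l u) x) \<partial>lborel)"
        proof (rule nn_integral_mono)
          fix x
          have "norm (G u x) = norm (\<sigma> u) * (exp (coord_sum (l u)) * norm (test ?\<kappa> \<xi> (c + l u) r (dil (l u) x) * f (dil (l u) x)))"
            by (simp add: G norm_mult)
          also have "\<dots> \<le> exp (coord_sum (l u)) * norm (test ?\<kappa> \<xi> (c + l u) r (dil (l u) x) * f (dil (l u) x))"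
            using norm_\<sigma>_le[of u] by (intro mult_left_le_one_le) auto
          finally show "ennreal (norm (G u x)) \<le> ennreal (exp (coord_sum (l u))) * ?k (dil (l u) x)"
            by (simp add: ennreal_leI flip: ennreal_mult)
        qed
        also have "\<dots> = ennreal (exp (coord_sum (l u))) * (\<integral>\<^sup>+x. ?k (dil (l u) x) \<partial>lborel)"
          by (rule nn_integral_cmult) measurable
        also have "\<dots> = (\<integral>\<^sup>+y. ?k y \<partial>lborel)" by (rule nn_integral_dil) measurable
        also have "\<dots> \<le> ennreal E" unfolding E_def by (rule test_bound[OF r])
        finally show "(\<integral>\<^sup>+x. ennreal (norm (G u x)) \<partial>lborel) \<le> ennreal E" .
      qed
      also have "\<dots> < \<infinity>" by (simp add: emeasure_eq_measure ennreal_mult_less_top)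
      finally show "(\<integral>\<^sup>+z. ennreal (norm (case z of (u, x) \<Rightarrow> G u x)) \<partial>(N \<Otimes>\<^sub>M lborel)) < \<infinity>" .
    qed measurable
    define I where "I d = (LINT y|lborel. test ?\<kappa> \<xi> d r y * f y)" for d
    have inner: "(LINT x|lborel. G u x) = \<sigma> u * cis (\<xi> \<bullet> l u) * I (c + l u)" for u
    proof -
      have "(LINT x|lborel. G u x) = exp (coord_sum (l u)) *\<^sub>R (LINT x|lborel. \<sigma> u * cis (\<xi> \<bullet> l u)
          * (test ?\<kappa> \<xi> (c + l u) r (dil (l u) x) * f (dil (l u) x)))"
        unfolding G scaleR_conv_of_real by simp
      also have "\<dots> = (LINT x|lborel. \<sigma> u * cis (\<xi> \<bullet> l u) * (test ?\<kappa> \<xi> (c + l u) r x * f x))"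
        by (rule integral_dil[where g="\<lambda>x. \<sigma> u * cis (\<xi> \<bullet> l u) * (test ?\<kappa> \<xi> (c + l u) r x * f x)"]) measurable
      also have "\<dots> = \<sigma> u * cis (\<xi> \<bullet> l u) * I (c + l u)" by (simp add: I_def)
      finally show ?thesis .
    qed
    have avg: "test ?\<kappa> \<xi> c r x * avg f x = (LINT u|N. G u x)" for x
      by (simp add: avg_def G_def)
    have int_avg: "integrable lborel (\<lambda>x. test ?\<kappa> \<xi> c r x * avg f x)"
      unfolding avg using P.integrable_snd[OF int_G] .
    have int_u: "integrable N (\<lambda>u. \<sigma> u * cis (\<xi> \<bullet> l u) * I (c + l u))"
      using P.integrable_fst[OF int_G] unfolding inner .
    have split: "test ?\<kappa> \<xi> c r x * (avg f x - symb \<xi> * f x) = test ?\<kappa> \<xi> c r x * avg f x - symb \<xi> * (test ?\<kappa> \<xi> c r x * f x)" for x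
      by (simp add: algebra_simps)
    have int: "integrable lborel (\<lambda>x. test ?\<kappa> \<xi> c r x * (avg f x - symb \<xi> * f x))"
      unfolding split using int_avg int_f[OF r] by auto
    have "(LINT x|lborel. test ?\<kappa> \<xi> c r x * (avg f x - symb \<xi> * f x))
      = (LINT x|lborel. test ?\<kappa> \<xi> c r x * avg f x) - symb \<xi> * I c"
      unfolding split using int_avg int_f[OF r] by (simp add: I_def)
    also have "(LINT x|lborel. test ?\<kappa> \<xi> c r x * avg f x) = (LINT u|N. LINT x|lborel. G u x)"
      unfolding avg by (rule P.Fubini_integral[OF int_G])
    also have "\<dots> - symb \<xi> * I c = (LINT u|N. \<sigma> u * cis (\<xi> \<bullet> l u) * I (c + l u)) - (LINT u|N. \<sigma> u * cis (\<xi> \<bullet> l u) * I c)"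
      unfolding inner symb_def by simp
    also have "\<dots> = (LINT u|N. \<sigma> u * cis (\<xi> \<bullet> l u) * I (c + l u) - \<sigma> u * cis (\<xi> \<bullet> l u) * I c)"
      using int_u integrable_\<sigma>_cis by (intro Bochner_Integration.integral_diff[symmetric]) auto
    finally have eq: "(LINT x|lborel. test ?\<kappa> \<xi> c r x * (avg f x - symb \<xi> * f x))
      = (LINT u|N. \<sigma> u * cis (\<xi> \<bullet> l u) * I (c + l u) - \<sigma> u * cis (\<xi> \<bullet> l u) * I c)" .
    have diff: "norm (I (c + d) - I c) \<le> displacement r d * (2 * E)" for d
    proof -
      have "I (c + d) - I c = (LINT x|lborel. test ?\<kappa> \<xi> (c + d) r x * f x - test ?\<kappa> \<xi> c r x * f x)"
        unfolding I_def using int_f[OF r] by simp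
      also have "\<dots> = (LINT x|lborel. (test ?\<kappa> \<xi> (c + d) r x - test ?\<kappa> \<xi> c r x) * f x)"
        by (simp add: left_diff_distrib)
      finally have I: "I (c + d) - I c = (LINT x|lborel. (test ?\<kappa> \<xi> (c + d) r x - test ?\<kappa> \<xi> c r x) * f x)" .
      have "integrable lborel (\<lambda>x. (test ?\<kappa> \<xi> (c + d) r x - test ?\<kappa> \<xi> c r x) * f x)"
        unfolding left_diff_distrib using int_f[OF r] by auto
      from integral_norm_bound_ennreal[OF this]
      have "ennreal (norm (I (c + d) - I c)) \<le> (\<integral>\<^sup>+x. ennreal (norm ((test ?\<kappa> \<xi> (c + d) r x - test ?\<kappa> \<xi> c r x) * f x)) \<partial>lborel)"
        unfolding I .
      also have "\<dots> \<le> (\<integral>\<^sup>+x. ennreal (displacement r d) *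
          (ennreal (indicator (cube (c + d) r) x * exp ((?\<kappa> - 1) * coord_sum (logc x)) * norm (f x))
         + ennreal (indicator (cube c r) x * exp ((?\<kappa> - 1) * coord_sum (logc x)) * norm (f x))) \<partial>lborel)"
      proof (rule nn_integral_mono)
        fix x
        have "norm ((test ?\<kappa> \<xi> (c + d) r x - test ?\<kappa> \<xi> c r x) * f x)
          \<le> displacement r d * (indicator (cube (c + d) r) x * exp ((?\<kappa> - 1) * coord_sum (logc x))
             + indicator (cube c r) x * exp ((?\<kappa> - 1) * coord_sum (logc x))) * norm (f x)"
          unfolding norm_mult by (intro mult_right_mono norm_test_diff_le[OF r]) auto
        also have "\<dots> = displacement r d * (indicator (cube (c + d) r) x * exp ((?\<kappa> - 1) * coord_sum (logc x)) * norm (f x)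
             + indicator (cube c r) x * exp ((?\<kappa> - 1) * coord_sum (logc x)) * norm (f x))"
          by (simp add: algebra_simps)
        finally show "ennreal (norm ((test ?\<kappa> \<xi> (c + d) r x - test ?\<kappa> \<xi> c r x) * f x)) \<le> ennreal (displacement r d) *
          (ennreal (indicator (cube (c + d) r) x * exp ((?\<kappa> - 1) * coord_sum (logc x)) * norm (f x))
         + ennreal (indicator (cube c r) x * exp ((?\<kappa> - 1) * coord_sum (logc x)) * norm (f x)))"
          using displacement_nonneg[OF r, of d] by (simp add: ennreal_leI flip: ennreal_mult ennreal_plus)
      qed
      also have "\<dots> = ennreal (displacement r d) *
          ((\<integral>\<^sup>+x. ennreal (indicator (cube (c + d) r) x * exp ((?\<kappa> - 1) * coord_sum (logc x)) * norm (f x)) \<partial>lborel)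
         + (\<integral>\<^sup>+x. ennreal (indicator (cube c r) x * exp ((?\<kappa> - 1) * coord_sum (logc x)) * norm (f x)) \<partial>lborel))"
        by (subst nn_integral_cmult, simp, subst nn_integral_add) simp_all
      also have "\<dots> \<le> ennreal (displacement r d) * (ennreal E + ennreal E)"
        unfolding E_def using C(2)[OF r] by (intro mult_left_mono add_mono) auto
      also have "\<dots> = ennreal (displacement r d * (2 * E))"
        using displacement_nonneg[OF r, of d] E by (simp flip: ennreal_mult ennreal_plus)
      finally show ?thesis
        using displacement_nonneg[OF r, of d] E by (subst (asm) ennreal_le_iff) auto
    qed
    have "norm (LINT u|N. \<sigma> u * cis (\<xi> \<bullet> l u) * I (c + l u) - \<sigma> u * cis (\<xi> \<bullet> l u) * I c)
      \<le> (LINT u|N. norm (\<sigma> u * cis (\<xi> \<bullet> l u) * I (c + l u) - \<sigma> u * cis (\<xi> \<bullet> l u) * I c))"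
      by (rule integral_norm_bound)
    also have "\<dots> \<le> (LINT u|N. displacement r (l u) * (2 * E))"
    proof (rule integral_mono)
      show "integrable N (\<lambda>u. norm (\<sigma> u * cis (\<xi> \<bullet> l u) * I (c + l u) - \<sigma> u * cis (\<xi> \<bullet> l u) * I c))"
        using int_u integrable_\<sigma>_cis by (intro integrable_norm Bochner_Integration.integrable_diff) auto
      show "integrable N (\<lambda>u. displacement r (l u) * (2 * E))" using displacement_integrable[OF r] by simp
      fix u
      have "norm (\<sigma> u * cis (\<xi> \<bullet> l u) * I (c + l u) - \<sigma> u * cis (\<xi> \<bullet> l u) * I c) = norm (\<sigma> u) * norm (I (c + l u) - I c)"
        by (simp add: norm_mult flip: right_diff_distrib)
      also have "\<dots> \<le> norm (I (c + l u) - I c)" using norm_\<sigma>_le[of u] by (intro mult_left_le_one_le) auto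
      also have "\<dots> \<le> displacement r (l u) * (2 * E)" by (rule diff)
      finally show "norm (\<sigma> u * cis (\<xi> \<bullet> l u) * I (c + l u) - \<sigma> u * cis (\<xi> \<bullet> l u) * I c) \<le> displacement r (l u) * (2 * E)" .
    qed
    also have "\<dots> = (2 * C) * r powr (CARD('n) * (1 - ?\<kappa>)) * (LINT u|N. displacement r (l u))"
      by (simp add: E_def)
    finally show ?thesis using int unfolding eq by blast
  qed
  show ?thesis using that[of "2 * C"] C(1) int_f main by simp
qed

end

section \<open>Infinite codimension of the range\<close>

context log_coordinates
begin

text \<open>The constant is 1/2 per coordinate from the height of the window, times 1/2 per
  coordinate from the side of the concentric cube.\<close>

lemma window_integral:
  assumes r: "0 < r"
  shows "integrable lborel (\<lambda>x. indicator (cube c r) x * exp (- coord_sum (logc x)) * window c r x)"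
    and "(1 / 4) ^ CARD('n) * r ^ CARD('n) \<le> (LINT x|lborel. indicator (cube c r) x * exp (- coord_sum (logc x)) * window c r x)"
proof -
  let ?w = "\<lambda>x. indicator (cube c r) x * exp (- coord_sum (logc x)) * window c r x"
  have nonneg: "0 \<le> ?w x" for x by (simp add: window_nonneg)
  show int: "integrable lborel ?w"
  proof (rule integrableI_bounded)
    have "(\<integral>\<^sup>+x. ennreal (norm (?w x)) \<partial>lborel) \<le> (\<integral>\<^sup>+x. ennreal (indicator (cube c r) x * exp (- coord_sum (logc x))) \<partial>lborel)"
    proof (intro nn_integral_mono ennreal_leI)
      fix x
      have "?w x \<le> indicator (cube c r) x * exp (- coord_sum (logc x))"
        using window_le_1[of c r x] window_nonneg[of c r x] by (intro mult_left_le) auto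
      then show "norm (?w x) \<le> indicator (cube c r) x * exp (- coord_sum (logc x))"
        using nonneg[of x] by (simp only: real_norm_def abs_of_nonneg)
    qed
    also have "\<dots> < \<infinity>" using r by (simp add: nn_integral_cube)
    finally show "(\<integral>\<^sup>+x. ennreal (norm (?w x)) \<partial>lborel) < \<infinity>" .
  qed measurable
  let ?c = "c + (\<chi> i. r / 4)"
  have sub: "x \<in> cube c r" if "x \<in> cube ?c (r / 2)" for x
  proof -
    have "c $ i \<le> logc x $ i \<and> logc x $ i \<le> c $ i + r" for i
    proof -
      have "c $ i + r / 4 \<le> logc x $ i" "logc x $ i \<le> c $ i + r / 4 + r / 2"
        using that by (auto simp: cube_def)
      then show ?thesis using r by linarith
    qed
    then show ?thesis using that by (simp add: cube_def)
  qed
  have "ennreal ((1 / 2) ^ CARD('n)) * ennreal ((r / 2) ^ CARD('n))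
    = (\<integral>\<^sup>+x. ennreal ((1 / 2) ^ CARD('n)) * ennreal (indicator (cube ?c (r / 2)) x * exp (- coord_sum (logc x))) \<partial>lborel)"
    using r by (subst nn_integral_cmult) (simp_all add: nn_integral_cube)
  also have "\<dots> \<le> (\<integral>\<^sup>+x. ennreal (?w x) \<partial>lborel)"
  proof (rule nn_integral_mono)
    fix x
    have "(1 / 2) ^ CARD('n) * (indicator (cube ?c (r / 2)) x * exp (- coord_sum (logc x))) \<le> ?w x"
    proof (cases "x \<in> cube ?c (r / 2)")
      case True
      then show ?thesis using window_lower[OF r True] sub[OF True] by (simp add: mult.commute)
    qed (use nonneg[of x] in simp)
    then show "ennreal ((1 / 2) ^ CARD('n)) * ennreal (indicator (cube ?c (r / 2)) x * exp (- coord_sum (logc x))) \<le> ennreal (?w x)"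
      by (simp add: ennreal_leI flip: ennreal_mult)
  qed
  also have "\<dots> = ennreal (LINT x|lborel. ?w x)" by (rule nn_integral_eq_integral[OF int]) (simp add: nonneg)
  finally have "(1 / 2) ^ CARD('n) * (r / 2) ^ CARD('n) \<le> (LINT x|lborel. ?w x)"
    using r nonneg by (simp add: ennreal_le_iff integral_nonneg flip: ennreal_mult)
  moreover have "(1 / 2) ^ CARD('n) * (r / 2) ^ CARD('n) = (1 / 4 :: real) ^ CARD('n) * r ^ CARD('n)"
    by (simp flip: power_mult_distrib)
  ultimately show "(1 / 4) ^ CARD('n) * r ^ CARD('n) \<le> (LINT x|lborel. ?w x)" by simp
qed

text \<open>\<open>bumps\<close> puts mass \<open>2 ^ -k\<close> (in \<open>L\<^sup>p\<close>) on the \<open>k\<close>-th cube, for \<open>k \<in> J\<close>, and oscillates with frequency \<open>\<xi>\<close>.\<close>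

definition bumps :: "real \<Rightarrow> real^'n \<Rightarrow> (nat \<Rightarrow> real^'n) \<Rightarrow> (nat \<Rightarrow> real) \<Rightarrow> nat set \<Rightarrow> real^'n \<Rightarrow> complex" where
  "bumps \<kappa> \<xi> c r J x = of_real ((\<Sum>k. if k \<in> J then (1 / 2) ^ k * r k powr (- real CARD('n) * \<kappa>) * indicator (cube (c k) (r k)) x else 0)
     * exp (- \<kappa> * coord_sum (logc x))) * cis (\<xi> \<bullet> logc x)"

lemma bumps_measurable [measurable]: "bumps \<kappa> \<xi> c r J \<in> borel_measurable borel"
  unfolding bumps_def[abs_def] cis_conv_exp by measurable

lemma bumps_outside: "(\<And>k. x \<notin> cube (c k) (r k)) \<Longrightarrow> bumps \<kappa> \<xi> c r J x = 0"
  by (simp add: bumps_def cong: if_cong)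

lemma bumps_on_cube:
  assumes disj: "\<And>j. x \<in> cube (c j) (r j) \<Longrightarrow> j = k" and x: "x \<in> cube (c k) (r k)"
  shows "bumps \<kappa> \<xi> c r J x = of_real ((if k \<in> J then (1 / 2) ^ k * r k powr (- real CARD('n) * \<kappa>) else 0)
     * exp (- \<kappa> * coord_sum (logc x))) * cis (\<xi> \<bullet> logc x)"
proof -
  have "(\<Sum>j. if j \<in> J then (1 / 2) ^ j * r j powr (- real CARD('n) * \<kappa>) * indicator (cube (c j) (r j)) x else 0)
    = (\<Sum>j\<in>{k}. if j \<in> J then (1 / 2) ^ j * r j powr (- real CARD('n) * \<kappa>) * indicator (cube (c j) (r j)) x else 0)"
    by (rule suminf_finite) (use disj in \<open>auto simp: indicator_def\<close>)
  then show ?thesis using x by (simp add: bumps_def)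
qed

text \<open>For finite \<open>p\<close>, the power of \<open>r k\<close> normalises each bump so
  that its \<open>p\<close>-th power integrates to at most \<open>(1 / 2) ^ k\<close>, a summable
  bound. For infinite \<open>p\<close>, the cubes are disjoint and each bump is at most 1 in
  modulus.\<close>

lemma bumps_Lp:
  assumes p: "1 \<le> p" and r: "\<And>k. 0 < r k"
    and disj: "\<And>x j k. x \<in> cube (c j) (r j) \<Longrightarrow> x \<in> cube (c k) (r k) \<Longrightarrow> j = k"
  shows "bumps (inv_exp p) \<xi> c r J \<in> Lp_space p"
proof (cases "p = \<infinity>")
  case True
  have "norm (bumps (inv_exp p) \<xi> c r J x) \<le> 1" for x
  proof (cases "\<exists>k. x \<in> cube (c k) (r k)")
    case ex: True
    then obtain k where k: "x \<in> cube (c k) (r k)" by blast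
    have "r k powr 0 = 1" using r[of k] by simp
    moreover have b: "bumps (inv_exp p) \<xi> c r J x = of_real ((if k \<in> J then (1 / 2) ^ k * r k powr (- real CARD('n) * inv_exp p) else 0)
        * exp (- inv_exp p * coord_sum (logc x))) * cis (\<xi> \<bullet> logc x)"
      by (rule bumps_on_cube) (use disj k in auto)
    ultimately show ?thesis unfolding b using True
      by (simp add: inv_exp_def norm_mult power_le_one norm_power norm_divide)
  next
    case False
    then show ?thesis by (simp add: bumps_outside)
  qed
  then have "esssup lborel (\<lambda>x. ereal (norm (bumps (inv_exp p) \<xi> c r J x))) \<le> 1"
    by (intro esssup_I) auto
  then show ?thesis using True by (auto simp: Lp_space_def intro: le_less_trans)
next
  case False
  define P where "P = enn2real p"
  have "p = ennreal P" using False by (simp add: P_def less_top)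
  then have "ennreal 1 \<le> ennreal P" using p by simp
  then have P: "1 \<le> P" by (subst (asm) ennreal_le_iff) (simp_all add: P_def)
  have \<kappa>: "inv_exp p = 1 / P" using False by (simp add: inv_exp_def P_def)
  let ?n = "real CARD('n)"
  define g where "g k x = ennreal ((1 / 2) ^ k * r k powr (- ?n)) * ennreal (indicator (cube (c k) (r k)) x * exp (- coord_sum (logc x)))" for k x
  have "(\<integral>\<^sup>+x. ennreal (norm (bumps (inv_exp p) \<xi> c r J x) powr P) \<partial>lborel) \<le> (\<integral>\<^sup>+x. (\<Sum>k. g k x) \<partial>lborel)"
  proof (rule nn_integral_mono)
    fix x
    show "ennreal (norm (bumps (inv_exp p) \<xi> c r J x) powr P) \<le> (\<Sum>k. g k x)"
    proof (cases "\<exists>k. x \<in> cube (c k) (r k)")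
      case True
      then obtain k where k: "x \<in> cube (c k) (r k)" by blast
      let ?a = "(1 / 2) ^ k * r k powr (- ?n * (1 / P)) * exp (- (1 / P) * coord_sum (logc x))"
      have b: "bumps (inv_exp p) \<xi> c r J x = of_real ((if k \<in> J then (1 / 2) ^ k * r k powr (- real CARD('n) * inv_exp p) else 0)
        * exp (- inv_exp p * coord_sum (logc x))) * cis (\<xi> \<bullet> logc x)"
      by (rule bumps_on_cube) (use disj k in auto)
      have "norm (bumps (inv_exp p) \<xi> c r J x) \<le> ?a"
        unfolding b by (simp add: \<kappa> norm_mult norm_power norm_divide)
      then have "norm (bumps (inv_exp p) \<xi> c r J x) powr P \<le> ?a powr P"
        using P by (intro powr_mono2) auto
      also have "?a powr P = ((1 / 2) ^ k) powr P * (r k powr (- ?n) * exp (- coord_sum (logc x)))"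
        using P r[of k] by (simp add: powr_mult powr_powr exp_powr_real)
      also have "\<dots> \<le> (1 / 2) ^ k * (r k powr (- ?n) * exp (- coord_sum (logc x)))"
      proof (rule mult_right_mono)
        have "((1 / 2 :: real) ^ k) powr P \<le> ((1 / 2) ^ k) powr 1"
          using P by (intro powr_mono') (auto simp: power_le_one)
        then show "((1 / 2 :: real) ^ k) powr P \<le> (1 / 2) ^ k" by simp
      qed auto
      finally have "ennreal (norm (bumps (inv_exp p) \<xi> c r J x) powr P)
        \<le> ennreal ((1 / 2) ^ k * (r k powr (- ?n) * exp (- coord_sum (logc x))))" by (rule ennreal_leI)
      also have "\<dots> = g k x" using k by (simp add: g_def mult.assoc flip: ennreal_mult)
      also have "\<dots> = sum (\<lambda>k. g k x) {k}" by simp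
      also have "\<dots> \<le> (\<Sum>k. g k x)" by (rule sum_le_suminf) auto
      finally show ?thesis .
    next
      case False
      then show ?thesis by (simp add: bumps_outside)
    qed
  qed
  also have "\<dots> = (\<Sum>k. \<integral>\<^sup>+x. g k x \<partial>lborel)"
    unfolding g_def by (rule nn_integral_suminf) measurable
  also have "\<dots> = (\<Sum>k. ennreal ((1 / 2) ^ k))"
  proof (rule suminf_cong)
    fix k
    have "(\<integral>\<^sup>+x. g k x \<partial>lborel) = ennreal ((1 / 2) ^ k * r k powr (- ?n)) * ennreal (r k ^ CARD('n))"
      unfolding g_def using r[of k] by (subst nn_integral_cmult) (simp_all add: nn_integral_cube)
    also have "\<dots> = ennreal ((1 / 2) ^ k * (r k powr (- ?n) * r k powr ?n))"
      using r[of k] by (simp add: powr_realpow mult.assoc flip: ennreal_mult)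
    also have "r k powr (- ?n) * r k powr ?n = 1" using r[of k] by (simp flip: powr_add)
    finally show "(\<integral>\<^sup>+x. g k x \<partial>lborel) = ennreal ((1 / 2) ^ k)" by simp
  qed
  also have "\<dots> = ennreal (\<Sum>k. (1 / 2) ^ k)"
    by (rule suminf_ennreal2) (auto intro: summable_geometric)
  also have "\<dots> < \<infinity>" by simp
  finally show ?thesis using False by (simp add: Lp_space_def P_def)
qed

text \<open>The exponents \<kappa> - 1 and - \<kappa> add up to -1 and the phases cancel, which
  leaves a nonnegative integrand without oscillation.\<close>

lemma test_bumps:
  assumes r: "0 < r k" and disj: "\<And>x j. x \<in> cube (c j) (r j) \<Longrightarrow> x \<in> cube (c k) (r k) \<Longrightarrow> j = k"
  shows "test \<kappa> \<xi> (c k) (r k) x * bumps \<kappa> \<xi> c r J x = of_real ((if k \<in> J then (1 / 2) ^ k * r k powr (- real CARD('n) * \<kappa>) else 0)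
     * (indicator (cube (c k) (r k)) x * exp (- coord_sum (logc x)) * window (c k) (r k) x))"
proof (cases "x \<in> cube (c k) (r k)")
  case True
  then have o: "x \<in> orthant" by (simp add: cube_def)
  have "exp ((\<kappa> - 1) * coord_sum (logc x)) * exp (- \<kappa> * coord_sum (logc x)) = exp (- coord_sum (logc x))"
    by (simp add: algebra_simps flip: exp_add)
  then have e: "complex_of_real (exp ((\<kappa> - 1) * coord_sum (logc x))) * exp (- \<kappa> * coord_sum (logc x)) = exp (- coord_sum (logc x))"
    by (metis of_real_mult)
  have ci: "cis (- (\<xi> \<bullet> logc x)) * cis (\<xi> \<bullet> logc x) = 1" by (simp add: cis_mult)
  define A where "A = (if k \<in> J then (1 / 2) ^ k * r k powr (- real CARD('n) * \<kappa>) else 0)"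
  have b: "bumps \<kappa> \<xi> c r J x = of_real (A * exp (- \<kappa> * coord_sum (logc x))) * cis (\<xi> \<bullet> logc x)"
    unfolding A_def by (rule bumps_on_cube) (use disj True in auto)
  have "test \<kappa> \<xi> (c k) (r k) x * bumps \<kappa> \<xi> c r J x
    = (complex_of_real (exp ((\<kappa> - 1) * coord_sum (logc x))) * exp (- \<kappa> * coord_sum (logc x)))
      * (cis (- (\<xi> \<bullet> logc x)) * cis (\<xi> \<bullet> logc x)) * (A * window (c k) (r k) x)"
    unfolding b using o by (simp add: test_def mult_ac)
  also have "\<dots> = of_real (A * (indicator (cube (c k) (r k)) x * exp (- coord_sum (logc x)) * window (c k) (r k) x))"
    unfolding e ci using True by (simp add: mult_ac)
  finally show ?thesis unfolding A_def .
next
  case False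
  then show ?thesis using norm_test_le[OF r, of \<kappa> \<xi> "c k" x] by simp
qed

end

section \<open>The gliding hump\<close>

context dilation_average
begin

lemma separated_cubes:
  obtains c :: "nat \<Rightarrow> real^'n" and r :: "nat \<Rightarrow> real"
  where "\<And>k. 0 < r k" "\<And>k. (LINT u|N. displacement (r k) (l u)) \<le> (1 / 4) ^ k"
    "\<And>x j k. x \<in> cube (c j) (r j) \<Longrightarrow> x \<in> cube (c k) (r k) \<Longrightarrow> j = k"
proof -
  have "\<exists>r. 0 < r \<and> (LINT u|N. displacement r (l u)) \<le> (1 / 4) ^ k" for k :: nat
    using displacement_integral_small[of "(1 / 4) ^ k"] by (metis less_imp_le zero_less_power zero_less_divide_1_iff zero_less_numeral)
  then obtain r where r: "\<And>k::nat. 0 < r k" "\<And>k. (LINT u|N. displacement (r k) (l u)) \<le> (1 / 4) ^ k"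
    by metis
  \<comment> \<open>The corners move along the diagonal; the extra 1 keeps successive closed cubes
    from touching.\<close>
  define b where "b k = (\<Sum>j<k. r j + 1)" for k
  have b: "b j + r j < b k" if "j < k" for j k
  proof -
    have "b (Suc j) \<le> b k" unfolding b_def using that r(1) by (intro sum_mono2) (auto simp: less_imp_le add_nonneg_nonneg)
    then show ?thesis by (simp add: b_def)
  qed
  \<comment> \<open>A single coordinate separates the cubes; the index \<open>undefined\<close>
    stands for an arbitrary one.\<close>
  have False if "x \<in> cube (\<chi> i. b j) (r j)" "x \<in> cube (\<chi> i. b k) (r k)" "j < k" for x j k
    using that b[OF that(3)] unfolding cube_def by (auto dest!: spec[of _ undefined])
  then have "j = k" if "x \<in> cube (\<chi> i. b j) (r j)" "x \<in> cube (\<chi> i. b k) (r k)" for x j k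
    using that by (meson linorder_neqE_nat)
  then show ?thesis using that[of r "\<lambda>k. \<chi> i. b k"] r by blast
qed

theorem finite_cokernel_contradiction:
  assumes F: "finite F" "F \<subseteq> Lp_space p"
    and surj: "\<And>h. h \<in> Lp_space p \<Longrightarrow> \<exists>f\<in>Lp_space p. \<exists>c. AE x in lborel. h x = (avg f x - symb \<xi> * f x) + (\<Sum>g\<in>F. c g * g x)"
  shows False
proof -
  let ?\<kappa> = "inv_exp p" and ?n = "real CARD('n)"
  obtain c r where r: "\<And>k. 0 < r k" and small: "\<And>k. (LINT u|N. displacement (r k) (l u)) \<le> (1 / 4) ^ k"
    and disj: "\<And>x j k. x \<in> cube (c j) (r j) \<Longrightarrow> x \<in> cube (c k) (r k) \<Longrightarrow> j = k"
    using separated_cubes by metis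
  \<comment> \<open>One more class than \<open>F\<close> has elements, so that some nontrivial
    combination of the classes has no component along \<open>F\<close>.\<close>
  define m where "m = Suc (card F)"
  define h where "h j = bumps ?\<kappa> \<xi> c r {k. k mod m = j}" for j
  have hLp: "h j \<in> Lp_space p" for j unfolding h_def by (rule bumps_Lp[OF p_ge_1 r disj])
  have "\<forall>j. \<exists>f. f \<in> Lp_space p \<and> (\<exists>d. AE x in lborel. h j x = (avg f x - symb \<xi> * f x) + (\<Sum>g\<in>F. d g * g x))"
    using surj[OF hLp] unfolding Bex_def ..
  from choice[OF this] obtain f where
    f': "\<forall>j. f j \<in> Lp_space p \<and> (\<exists>d. AE x in lborel. h j x = (avg (f j) x - symb \<xi> * f j x) + (\<Sum>g\<in>F. d g * g x))" ..
  have f: "f j \<in> Lp_space p" for j using f' by simp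
  have "\<forall>j. \<exists>d. AE x in lborel. h j x = (avg (f j) x - symb \<xi> * f j x) + (\<Sum>g\<in>F. d g * g x)"
    using f' by simp
  from choice[OF this] obtain d where
    hf: "\<And>j. AE x in lborel. h j x = (avg (f j) x - symb \<xi> * f j x) + (\<Sum>g\<in>F. d j g * g x)" by auto
  obtain a j0 where j0: "j0 < m" "a j0 \<noteq> 0" and a: "\<And>g. g \<in> F \<Longrightarrow> (\<Sum>j<m. a j * d j g) = 0"
    using exists_nontrivial_relation[OF F(1), of "{..<m}" d] by (auto simp: m_def)
  have "\<forall>j. \<exists>C. 0 \<le> C \<and> (\<forall>k. integrable lborel (\<lambda>x. test ?\<kappa> \<xi> (c k) (r k) x * (avg (f j) x - symb \<xi> * f j x)) \<and>
     norm (LINT x|lborel. test ?\<kappa> \<xi> (c k) (r k) x * (avg (f j) x - symb \<xi> * f j x))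
       \<le> C * r k powr (?n * (1 - ?\<kappa>)) * (LINT u|N. displacement (r k) (l u)))"
  proof
    fix j
    show "\<exists>C. 0 \<le> C \<and> (\<forall>k. integrable lborel (\<lambda>x. test ?\<kappa> \<xi> (c k) (r k) x * (avg (f j) x - symb \<xi> * f j x)) \<and>
     norm (LINT x|lborel. test ?\<kappa> \<xi> (c k) (r k) x * (avg (f j) x - symb \<xi> * f j x))
       \<le> C * r k powr (?n * (1 - ?\<kappa>)) * (LINT u|N. displacement (r k) (l u)))"
    proof (rule pairing[OF f[of j]])
      fix C assume "0 \<le> C"
        and 1: "\<And>\<xi> c r. 0 < r \<Longrightarrow> integrable lborel (\<lambda>x. test ?\<kappa> \<xi> c r x * (avg (f j) x - symb \<xi> * f j x))"
        and 2: "\<And>\<xi> c r. 0 < r \<Longrightarrow> norm (LINT x|lborel. test ?\<kappa> \<xi> c r x * (avg (f j) x - symb \<xi> * f j x))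
          \<le> C * r powr (?n * (1 - ?\<kappa>)) * (LINT u|N. displacement r (l u))"
      show ?thesis by (intro exI[of _ C] conjI allI \<open>0 \<le> C\<close> 1 2 r)
    qed
  qed
  from choice[OF this] obtain C where C: "\<And>j. 0 \<le> C j"
    and int: "\<And>j k. integrable lborel (\<lambda>x. test ?\<kappa> \<xi> (c k) (r k) x * (avg (f j) x - symb \<xi> * f j x))"
    and bound: "\<And>j k. norm (LINT x|lborel. test ?\<kappa> \<xi> (c k) (r k) x * (avg (f j) x - symb \<xi> * f j x))
       \<le> C j * r k powr (?n * (1 - ?\<kappa>)) * (LINT u|N. displacement (r k) (l u))"
    by auto
  define B where "B = (\<Sum>j<m. norm (a j) * C j)"
  \<comment> \<open>On a cube of the class of \<open>j0\<close> the bumps of all other classes pair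
    to 0, so the coefficient \<open>a j0\<close> is isolated.\<close>
  have ineq: "norm (a j0) * (1 / 4) ^ CARD('n) * 2 ^ k \<le> B" if k: "k mod m = j0" for k
  proof -
    define S where "S j = (LINT x|lborel. test ?\<kappa> \<xi> (c k) (r k) x * (avg (f j) x - symb \<xi> * f j x))" for j
    define G where "G g = (LINT x|lborel. test ?\<kappa> \<xi> (c k) (r k) x * g x)" for g
    define I where "I = (LINT x|lborel. indicator (cube (c k) (r k)) x * exp (- coord_sum (logc x)) * window (c k) (r k) x)"
    define w where "w = (1 / 2) ^ k * r k powr (- ?n * ?\<kappa>)"
    have int_g: "integrable lborel (\<lambda>x. test ?\<kappa> \<xi> (c k) (r k) x * g x)" if "g \<in> F" for g
    proof -
      have "g \<in> Lp_space p" using that F(2) by blast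
      from pairing[OF this] show ?thesis using r[of k] by metis
    qed
    have "(LINT x|lborel. test ?\<kappa> \<xi> (c k) (r k) x * h j x) = S j + (\<Sum>g\<in>F. d j g * G g)" for j
    proof -
      have [measurable]: "g \<in> borel_measurable borel" if "g \<in> F" for g using that F by (auto simp: Lp_space_def)
      have int_sum: "integrable lborel (\<lambda>x. \<Sum>g\<in>F. d j g * (test ?\<kappa> \<xi> (c k) (r k) x * g x))"
        using int_g by (intro Bochner_Integration.integrable_sum) auto
      have [measurable]: "h j \<in> borel_measurable borel" unfolding h_def by measurable
      have "(LINT x|lborel. test ?\<kappa> \<xi> (c k) (r k) x * h j x)
        = (LINT x|lborel. test ?\<kappa> \<xi> (c k) (r k) x * (avg (f j) x - symb \<xi> * f j x)
            + (\<Sum>g\<in>F. d j g * (test ?\<kappa> \<xi> (c k) (r k) x * g x)))"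
      proof (rule integral_cong_AE)
        show "(\<lambda>x. test ?\<kappa> \<xi> (c k) (r k) x * (avg (f j) x - symb \<xi> * f j x)
            + (\<Sum>g\<in>F. d j g * (test ?\<kappa> \<xi> (c k) (r k) x * g x))) \<in> borel_measurable lborel"
          using int[of k j] int_sum by (intro borel_measurable_integrable Bochner_Integration.integrable_add)
        show "AE x in lborel. test ?\<kappa> \<xi> (c k) (r k) x * h j x
          = test ?\<kappa> \<xi> (c k) (r k) x * (avg (f j) x - symb \<xi> * f j x)
            + (\<Sum>g\<in>F. d j g * (test ?\<kappa> \<xi> (c k) (r k) x * g x))"
          using hf[of j]
        proof eventually_elim
          case (elim x)
          then show ?case by (simp only: distrib_left sum_distrib_left mult.left_commute)
        qed
      qed measurable
      also have "\<dots> = S j + (LINT x|lborel. (\<Sum>g\<in>F. d j g * (test ?\<kappa> \<xi> (c k) (r k) x * g x)))"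
        unfolding S_def by (rule Bochner_Integration.integral_add[OF int int_sum])
      also have "(LINT x|lborel. (\<Sum>g\<in>F. d j g * (test ?\<kappa> \<xi> (c k) (r k) x * g x))) = (\<Sum>g\<in>F. d j g * G g)"
        using int_g by (subst Bochner_Integration.integral_sum) (auto simp: G_def)
      finally show ?thesis .
    qed
    then have "(\<Sum>j<m. a j * (LINT x|lborel. test ?\<kappa> \<xi> (c k) (r k) x * h j x))
      = (\<Sum>j<m. a j * S j) + (\<Sum>j<m. \<Sum>g\<in>F. a j * d j g * G g)"
      by (simp add: distrib_left sum.distrib sum_distrib_left mult.assoc)
    also have "(\<Sum>j<m. \<Sum>g\<in>F. a j * d j g * G g) = (\<Sum>g\<in>F. (\<Sum>j<m. a j * d j g) * G g)"
      by (subst sum.swap) (simp add: sum_distrib_right)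
    also have "\<dots> = 0" using a by simp
    finally have "(\<Sum>j<m. a j * (LINT x|lborel. test ?\<kappa> \<xi> (c k) (r k) x * h j x)) = (\<Sum>j<m. a j * S j)" by simp
    moreover have "(LINT x|lborel. test ?\<kappa> \<xi> (c k) (r k) x * h j x) = (if j = j0 then of_real (w * I) else 0)" for j
    proof -
      have tb: "test ?\<kappa> \<xi> (c k) (r k) x * h j x = of_real ((if j = j0 then w else 0)
        * (indicator (cube (c k) (r k)) x * exp (- coord_sum (logc x)) * window (c k) (r k) x))" for x
        using test_bumps[where c=c and r=r and k=k and J="{k. k mod m = j}", OF r disj] k
        by (auto simp: h_def w_def)
      show ?thesis unfolding tb integral_complex_of_real I_def by simp
    qed
    ultimately have eq: "a j0 * of_real (w * I) = (\<Sum>j<m. a j * S j)"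
      using j0(1) by (simp add: if_distrib cong: if_cong)
    have I: "(1 / 4) ^ CARD('n) * r k ^ CARD('n) \<le> I" unfolding I_def by (rule window_integral[OF r])
    have w: "0 \<le> w" by (simp add: w_def)
    have I0: "0 \<le> I" using I r[of k] by (smt (verit) mult_nonneg_nonneg zero_le_power divide_nonneg_nonneg)
    \<comment> \<open>The mass of the bumps and the error in \<open>pairing\<close> scale with the
      same power of the side, so the uncontrolled numbers \<open>r k\<close> cancel.\<close>
    define R where "R = r k powr (?n * (1 - ?\<kappa>))"
    have R: "0 < R" using r[of k] by (simp add: R_def)
    have rR: "r k powr (- ?n * ?\<kappa>) * r k ^ CARD('n) = R"
      using r[of k] by (simp add: R_def algebra_simps flip: powr_realpow powr_add)
    have "norm (a j0) * ((1 / 2) ^ k * (1 / 4) ^ CARD('n) * R) = norm (a j0) * (w * ((1 / 4) ^ CARD('n) * r k ^ CARD('n)))"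
      unfolding rR[symmetric] w_def by (simp only: mult_ac)
    also have "\<dots> \<le> norm (a j0) * (w * I)"
      using I w by (intro mult_left_mono) auto
    also have "\<dots> = norm (a j0 * of_real (w * I))" using w I0 by (simp add: norm_mult)
    also have "\<dots> \<le> (\<Sum>j<m. norm (a j * S j))" unfolding eq by (rule norm_sum)
    also have "\<dots> \<le> (\<Sum>j<m. norm (a j) * C j * (R * (1 / 4) ^ k))"
    proof (rule sum_mono)
      fix j
      have "norm (S j) \<le> C j * R * (LINT u|N. displacement (r k) (l u))"
        unfolding S_def R_def by (rule bound)
      also have "\<dots> \<le> C j * R * (1 / 4) ^ k" using small C R by (intro mult_left_mono) auto
      finally have "norm (a j) * norm (S j) \<le> norm (a j) * (C j * R * (1 / 4) ^ k)" by (intro mult_left_mono) auto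
      then show "norm (a j * S j) \<le> norm (a j) * C j * (R * (1 / 4) ^ k)" by (simp add: norm_mult mult.assoc)
    qed
    also have "\<dots> = B * (1 / 4) ^ k * R" by (simp add: B_def sum_distrib_left mult_ac)
    finally have "(norm (a j0) * ((1 / 2) ^ k * (1 / 4) ^ CARD('n))) * R \<le> (B * (1 / 4) ^ k) * R"
      by (simp only: mult.assoc)
    then have "norm (a j0) * ((1 / 2) ^ k * (1 / 4) ^ CARD('n)) \<le> B * (1 / 4) ^ k"
      using R by (rule mult_right_le_imp_le)
    \<comment> \<open>Clearing the error rate \<open>(1 / 4) ^ k\<close> against the mass
      \<open>(1 / 2) ^ k\<close> leaves the growing factor \<open>2 ^ k\<close>.\<close>
    then have le: "norm (a j0) * ((1 / 2) ^ k * (1 / 4) ^ CARD('n)) * 4 ^ k \<le> B * (1 / 4) ^ k * 4 ^ k"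
      by (intro mult_right_mono) auto
    have e1: "norm (a j0) * ((1 / 2) ^ k * (1 / 4) ^ CARD('n)) * 4 ^ k = norm (a j0) * (1 / 4) ^ CARD('n) * ((1 / 2) ^ k * 4 ^ k)"
      by (simp only: mult_ac)
    have e2: "(1 / 2 :: real) ^ k * 4 ^ k = 2 ^ k" "(1 / 4 :: real) ^ k * 4 ^ k = 1"
      by (simp_all flip: power_mult_distrib)
    show ?thesis using le unfolding e1 mult.assoc[of B] e2 by simp
  qed
  define q where "q = norm (a j0) * (1 / 4) ^ CARD('n)"
  have q: "0 < q" using j0 by (simp add: q_def)
  obtain t where t: "B / q < 2 ^ t" using real_arch_pow[of 2 "B / q"] by auto
  \<comment> \<open>The index \<open>j0 + m * t\<close> belongs to the class of \<open>j0\<close>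
    and is at least \<open>t\<close>.\<close>
  have 2: "(2::real) ^ t \<le> 2 ^ (j0 + m * t)"
    by (intro power_increasing) (auto simp: m_def)
  have "B < q * 2 ^ t" using t q by (simp add: pos_divide_less_eq mult.commute)
  also have "\<dots> \<le> q * 2 ^ (j0 + m * t)" using 2 q by (intro mult_left_mono) auto
  also have "\<dots> \<le> B" unfolding q_def using j0 by (intro ineq) simp
  finally show False by simp
qed

end

section \<open>Hausdorff operators\<close>

context log_coordinates
begin

lemma symmetric_matrix_eq_dil:
  assumes sym: "transpose B = B" and eig: "\<And>i. B *v row i Q = exp (l $ i) *\<^sub>R row i Q"
  shows "B *v x = dil l x" and "det B = exp (coord_sum l)"
proof -
  have QB: "Q *v (B *v y) = (\<chi> i. exp (l $ i) * (Q *v y) $ i)" for y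
  proof -
    have "(Q *v (B *v y)) $ i = exp (l $ i) * (Q *v y) $ i" for i
    proof -
      have "(Q *v (B *v y)) $ i = row i Q \<bullet> (B *v y)" by (simp add: matrix_vector_mul_component row_def)
      also have "\<dots> = (B *v row i Q) \<bullet> y" by (simp add: symmetric_matrix_inner[OF sym])
      also have "\<dots> = exp (l $ i) * (Q *v y) $ i" unfolding eig by (simp add: matrix_vector_mul_component row_def)
      finally show ?thesis .
    qed
    then show ?thesis by (simp add: vec_eq_iff)
  qed
  show *: "B *v x = dil l x" for x
    using Qt_Q[of "B *v x"] unfolding QB dil_def by simp
  define E :: "real^'n^'n" where "E = (\<chi> i j. if i = j then exp (l $ i) else 0)"
  have E: "E *v y = (\<chi> i. exp (l $ i) * y $ i)" for y
    by (simp add: E_def matrix_vector_mult_def vec_eq_iff if_distrib[of "\<lambda>t. t * _"] cong: if_cong)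
  have "B = transpose Q ** E ** Q"
    unfolding matrix_eq * dil_def by (simp add: E flip: matrix_vector_mul_assoc)
  then have "det B = det Q * det Q * det E" by (simp add: det_mul det_transpose mult_ac)
  also have "det Q * det Q = 1" using det_orthogonal_matrix[OF Q] by auto
  also have "det E = (\<Prod>i\<in>UNIV. E $ i $ i)" by (rule det_diagonal) (simp add: E_def)
  also have "\<dots> = exp (coord_sum l)" by (simp add: E_def coord_sum_def exp_sum)
  finally show "det B = exp (coord_sum l)" by simp
qed

end

text \<open>If the transform vanished identically, \<sigma> times any measurable function of
  \<open>l u\<close> would integrate to 0. For fixed \<open>x\<close>, the remaining factors of the
  integrand of \<open>avg f x\<close> form such a function.\<close>

lemma (in dilation_average) symb_nonzero:
  assumes f: "f \<in> borel_measurable borel" and nz: "avg f x \<noteq> 0"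
  obtains \<xi> where "symb \<xi> \<noteq> 0"
proof (rule ccontr)
  assume "\<not> thesis"
  then have 0: "(LINT u|N. \<sigma> u * cis (\<xi> \<bullet> l u)) = 0" for \<xi> using that unfolding symb_def by blast
  have [measurable]: "f \<in> borel_measurable borel" by fact
  have "(LINT u|N. \<sigma> u * (exp (inv_exp p * coord_sum (l u)) * f (dil (l u) x))) = 0"
    by (rule complex_weight_eq_0[OF integrable_\<sigma> l_measurable 0,
          where g="\<lambda>y. exp (inv_exp p * coord_sum y) * f (dil y x)"]) measurable
  then show False using nz by (simp add: avg_def mult.assoc)
qed

theorem theorem1:
  fixes M :: "'a::topological_space measure"
    and \<Phi> :: "'a \<Rightarrow> complex"
    and A :: "'a \<Rightarrow> real^'n^'n"
    and p :: ennreal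
  assumes "sigma_compact_space TYPE('a)"
    and "regular_borel_measure M"
    and "locally_integrable M \<Phi>"
    and "A \<in> borel_measurable M"
    and "\<forall>v \<in> closure {u. \<Phi> u \<noteq> 0}. \<forall>w \<in> closure {u. \<Phi> u \<noteq> 0}. A v ** A w = A w ** A v"
    and "\<forall>v \<in> closure {u. \<Phi> u \<noteq> 0}. pos_def_matrix (A v)"
    and "1 \<le> p"
    and "integrable M (\<lambda>v. complex_of_real (det (A v) powr (- inv_exp p)) * \<Phi> v)"
    and "\<exists>f \<in> Lp_space p. \<not> (AE x in lborel. hausdorff_op M \<Phi> A f x = 0)"
  shows "\<not> Lp_riesz p (hausdorff_op M \<Phi> A)"
proof
  assume riesz: "Lp_riesz p (hausdorff_op M \<Phi> A)"
  have A_meas[measurable]: "A \<in> borel_measurable M" by fact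
  have [measurable]: "\<Phi> \<in> borel_measurable M" using assms(3) by (simp add: locally_integrable_def)
  have supp: "u \<in> closure {u. \<Phi> u \<noteq> 0}" if "\<Phi> u \<noteq> 0" for u
    using that by (intro subsetD[OF closure_subset]) simp
  have pos: "pos_def_matrix (A u)" if "\<Phi> u \<noteq> 0" for u using bspec[OF assms(6) supp[OF that]] .
  have sym: "transpose B = B" if "B \<in> A ` {u. \<Phi> u \<noteq> 0}" for B
    using that pos by (auto simp: pos_def_matrix_def)
  have com: "B ** B' = B' ** B" if "B \<in> A ` {u. \<Phi> u \<noteq> 0}" "B' \<in> A ` {u. \<Phi> u \<noteq> 0}" for B B'
    using that bspec[OF bspec[OF assms(5) supp] supp] by auto
  obtain Q :: "real^'n^'n" where Q: "orthogonal_matrix Q"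
    and eig: "\<And>B i. B \<in> A ` {u. \<Phi> u \<noteq> 0} \<Longrightarrow> \<exists>e. B *v row i Q = e *\<^sub>R row i Q"
  proof (rule commuting_symmetric_diagonalization[of "A ` {u. \<Phi> u \<noteq> 0}", OF sym com])
    fix Q :: "real^'n^'n"
    assume "orthogonal_matrix Q" "\<And>B i. B \<in> A ` {u. \<Phi> u \<noteq> 0} \<Longrightarrow> \<exists>e. B *v row i Q = e *\<^sub>R row i Q"
    then show thesis by (rule that)
  qed
  interpret log_coordinates Q by unfold_locales (rule Q)
  have row: "norm (row i Q) = 1" for i using Q by (simp add: orthogonal_matrix_orthonormal_rows)
  \<comment> \<open>The Rayleigh quotient at the unit vector \<open>row i Q\<close> recovers the
    eigenvalue by a formula continuous in the matrix, hence measurable in \<open>u\<close>. The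
    default 0 is taken where the integrand vanishes anyway.\<close>
  define l :: "'a \<Rightarrow> real^'n" where
    "l u = (\<chi> i. if \<Phi> u \<noteq> 0 then ln (row i Q \<bullet> (A u *v row i Q)) else 0)" for u
  have [measurable]: "l \<in> borel_measurable M"
  proof (rule borel_measurable_vecI)
    fix i
    have "(\<lambda>B::real^'n^'n. row i Q \<bullet> (B *v row i Q)) \<in> borel_measurable borel"
      unfolding matrix_vector_mult_def inner_vec_def
      by (intro borel_measurable_continuous_onI) (auto intro!: continuous_intros)
    from measurable_compose[OF A_meas this]
    have [measurable]: "(\<lambda>u. row i Q \<bullet> (A u *v row i Q)) \<in> borel_measurable M" .
    show "(\<lambda>u. l u $ i) \<in> borel_measurable M" unfolding l_def by simp
  qed
  have dil: "A u *v x = dil (l u) x" and det: "det (A u) = exp (coord_sum (l u))" if u: "\<Phi> u \<noteq> 0" for u x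
  proof -
    have "A u *v row i Q = exp (l u $ i) *\<^sub>R row i Q" for i
    proof -
      obtain e where e: "A u *v row i Q = e *\<^sub>R row i Q" using eig u by blast
      moreover have "row i Q \<noteq> 0" using row[of i] by auto
      ultimately have "0 < e" using pos[OF u] unfolding pos_def_matrix_def by blast
      moreover have "row i Q \<bullet> row i Q = 1" using row[of i] by (simp add: norm_eq_1)
      ultimately show ?thesis using u e by (simp add: l_def)
    qed
    moreover have "transpose (A u) = A u" using pos[OF u] by (simp add: pos_def_matrix_def)
    ultimately show "A u *v x = dil (l u) x" "det (A u) = exp (coord_sum (l u))"
      using symmetric_matrix_eq_dil by blast+
  qed
  define w where "w u = complex_of_real (det (A u) powr (- inv_exp p)) * \<Phi> u" for u
  have w: "integrable M w" using assms(8) by (simp add: w_def[abs_def])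
  then have [measurable]: "w \<in> borel_measurable M" by auto
  have w_\<Phi>: "w u * exp (inv_exp p * coord_sum (l u)) = \<Phi> u" for u
  proof (cases "\<Phi> u = 0")
    case False
    have "det (A u) powr (- inv_exp p) * exp (inv_exp p * coord_sum (l u)) = 1"
      by (simp add: det[OF False] exp_powr_real mult.commute flip: exp_add)
    then have "complex_of_real (det (A u) powr (- inv_exp p)) * exp (inv_exp p * coord_sum (l u)) = 1"
      by (metis of_real_1 of_real_mult)
    then show ?thesis by (simp add: w_def mult_ac)
  qed (simp add: w_def)
  \<comment> \<open>Polar decomposition of the complex measure with density \<open>w\<close>. Where
    \<open>w\<close> vanishes, \<open>sgn\<close> gives phase 0, which still satisfies the bound by
    1.\<close>
  define N where "N = density M (\<lambda>u. ennreal (norm (w u)))"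
  define \<sigma> where "\<sigma> u = sgn (w u)" for u
  have \<sigma>_meas: "\<sigma> \<in> borel_measurable M" unfolding \<sigma>_def[abs_def] sgn_div_norm by measurable
  interpret dilation_average Q N \<sigma> l p
  proof (intro dilation_average.intro dilation_average_axioms.intro)
    show "log_coordinates Q" by unfold_locales
    show "finite_measure N"
    proof (rule finite_measureI)
      have "emeasure N (space N) = (\<integral>\<^sup>+u. ennreal (norm (w u)) \<partial>M)"
        by (simp add: N_def emeasure_density cong: nn_integral_cong)
      also have "\<dots> < \<infinity>" using w by (simp add: integrable_iff_bounded)
      finally show "emeasure N (space N) \<noteq> \<infinity>" by simp
    qed
    show "\<sigma> \<in> borel_measurable N" "l \<in> borel_measurable N" using \<sigma>_meas by (simp_all add: N_def)
    show "norm (\<sigma> u) \<le> 1" for u by (simp add: \<sigma>_def norm_sgn)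
  qed fact
  \<comment> \<open>The equality holds at every \<open>x\<close>, not only almost everywhere: the
    two integrands over \<open>M\<close> agree for each \<open>u\<close>, both being 0 where \<Phi>
    vanishes.\<close>
  have op: "hausdorff_op M \<Phi> A f x = avg f x" if f: "f \<in> Lp_space p" for f x
  proof -
    have [measurable]: "f \<in> borel_measurable borel" using f by (simp add: Lp_space_def)
    have [measurable]: "\<sigma> \<in> borel_measurable M" by (rule \<sigma>_meas)
    have "avg f x = (LINT u|M. norm (w u) *\<^sub>R (\<sigma> u * exp (inv_exp p * coord_sum (l u)) * f (dil (l u) x)))"
      unfolding avg_def unfolding N_def by (rule integral_density) auto
    also have "\<dots> = (LINT u|M. \<Phi> u * f (A u *v x))"
    proof (rule Bochner_Integration.integral_cong)
      fix u
      have "norm (w u) *\<^sub>R (\<sigma> u * exp (inv_exp p * coord_sum (l u)) * f (dil (l u) x))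
        = (norm (w u) *\<^sub>R \<sigma> u) * exp (inv_exp p * coord_sum (l u)) * f (dil (l u) x)" by simp
      also have "norm (w u) *\<^sub>R \<sigma> u = w u" by (cases "w u = 0") (simp_all add: \<sigma>_def sgn_div_norm)
      finally show "norm (w u) *\<^sub>R (\<sigma> u * exp (inv_exp p * coord_sum (l u)) * f (dil (l u) x)) = \<Phi> u * f (A u *v x)"
        unfolding w_\<Phi> using dil[of u x] by (cases "\<Phi> u = 0") auto
    qed simp
    finally show ?thesis by (simp add: hausdorff_op_def)
  qed
  obtain f x where f: "f \<in> Lp_space p" and "avg f x \<noteq> 0"
  proof -
    obtain f where f: "f \<in> Lp_space p" and nz: "\<not> (AE x in lborel. hausdorff_op M \<Phi> A f x = 0)"
      using assms(9) by (rule bexE)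
    have "\<not> (\<forall>x. avg f x = 0)" using nz op[OF f] by auto
    then show thesis using that f by blast
  qed
  then obtain \<xi> where \<xi>: "symb \<xi> \<noteq> 0"
    using symb_nonzero[of f x] by (auto simp: Lp_space_def)
  with riesz have "Lp_fredholm p (\<lambda>f x. hausdorff_op M \<Phi> A f x - symb \<xi> * f x)"
    by (simp add: Lp_riesz_def)
  then obtain F where "finite F" "F \<subseteq> Lp_space p" and
    F: "\<forall>h\<in>Lp_space p. \<exists>f\<in>Lp_space p. \<exists>c. AE x in lborel.
      h x = (hausdorff_op M \<Phi> A f x - symb \<xi> * f x) + (\<Sum>g\<in>F. c g * g x)"
    unfolding Lp_fredholm_def by blast
  show False
  proof (rule finite_cokernel_contradiction[OF \<open>finite F\<close> \<open>F \<subseteq> Lp_space p\<close>])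
    fix h :: "real^'n \<Rightarrow> complex" assume "h \<in> Lp_space p"
    from bspec[OF F this] obtain f c where f: "f \<in> Lp_space p"
      and "AE x in lborel. h x = (hausdorff_op M \<Phi> A f x - symb \<xi> * f x) + (\<Sum>g\<in>F. c g * g x)"
      by blast
    then have "AE x in lborel. h x = (avg f x - symb \<xi> * f x) + (\<Sum>g\<in>F. c g * g x)"
      by (simp add: op)
    then have "\<exists>c. AE x in lborel. h x = (avg f x - symb \<xi> * f x) + (\<Sum>g\<in>F. c g * g x)"
      by (rule exI[of _ c])
    with f show "\<exists>f\<in>Lp_space p. \<exists>c. AE x in lborel. h x = (avg f x - symb \<xi> * f x) + (\<Sum>g\<in>F. c g * g x)"
      by (intro bexI[of _ f])
  qed
qed

end
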